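(* Let $(R,\mathfrak{m})$ be a noetherian local integral domain. If the property 'pure-essential' is transitive for $R$-modules (i.e. whenever $A\subset B$ and $B\subset C$ are pure-essential extensions of $R$-modules, then $A\subset C$ is pure-essential), then $\dim(R)\le 1$.
   Context: An extension $A\subset B$ of $R$-modules is pure-essential if $A$ is pure in $B$ and, for every submodule $X\subset B$ with $X\cap A=0$ and $(X\oplus A)/X$ pure in $B/X$, one has $X=0$. *)

theory Defs
  imports "HOL-Algebra.Module" "HOL-Algebra.Ring_Divisibility" "HOL-Library.Extended_Nat"
begin

text \<open>
  Submodules are sets \<open>H\<close> with \<^const>\<open>submodule\<close> \<open>H R M\<close>; when such a set has to be regarded as
  a module in its own right we write \<open>M\<lparr>carrier := H\<rparr>\<close>.
\<close>

definition local_ring :: "('a, 'b) ring_scheme \<Rightarrow> 'a set \<Rightarrow> bool" where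
  "local_ring R \<mm> \<longleftrightarrow>
     cring R \<and> maximalideal \<mm> R \<and> (\<forall>J. maximalideal J R \<longrightarrow> J = \<mm>)"

definition krull_dim :: "('a, 'b) ring_scheme \<Rightarrow> enat" where
  "krull_dim R = Sup {enat n | n. \<exists>P :: nat \<Rightarrow> 'a set.
     (\<forall>i\<le>n. primeideal (P i) R) \<and> (\<forall>i<n. P i \<subset> P (Suc i))}"

text \<open>
  The quotient module, with the same carrier, addition and zero as \<open>M A_Mod Y\<close>. A coset \<open>S\<close> is
  multiplied by \<open>r\<close> by adding \<open>Y\<close> to the elementwise product, because \<open>{r \<odot> s | s. s \<in> S}\<close> alone
  is in general only contained in a coset. The record type of modules also has the (irrelevant)
  ring fields \<open>mult\<close> and \<open>one\<close>.
\<close>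

definition quot_module ::
    "('a, 'm, 'c) module_scheme \<Rightarrow> 'm set \<Rightarrow> ('a, 'm set) module" where
  "quot_module M Y =
     \<lparr>carrier = a_rcosets\<^bsub>M\<^esub> Y, monoid.mult = undefined, one = undefined,
      zero = Y, add = set_add M,
      smult = (\<lambda>r S. Y <+>\<^bsub>M\<^esub> ((\<lambda>s. r \<odot>\<^bsub>M\<^esub> s) ` S))\<rparr>"

definition quot_image :: "('a, 'm, 'c) module_scheme \<Rightarrow> 'm set \<Rightarrow> 'm set \<Rightarrow> 'm set set" where
  "quot_image M Y A = (\<lambda>y. Y +>\<^bsub>M\<^esub> y) ` A"

text \<open>
  Purity in the sense of Cohn: every finite system of \<open>n\<close> linear equations in \<open>k\<close> unknowns with
  coefficients in \<open>R\<close> and right-hand sides in \<open>A\<close> that is solvable in \<open>M\<close> is solvable in \<open>A\<close>.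
\<close>

definition pure_submodule ::
    "('a, 'b) ring_scheme \<Rightarrow> ('a, 'm, 'c) module_scheme \<Rightarrow> 'm set \<Rightarrow> bool" where
  "pure_submodule R M A \<longleftrightarrow> submodule A R M \<and>
     (\<forall>(n::nat) (k::nat) r a.
        (\<forall>i<n. \<forall>j<k. r i j \<in> carrier R) \<longrightarrow> (\<forall>i<n. a i \<in> A) \<longrightarrow>
        (\<exists>y. (\<forall>j<k. y j \<in> carrier M) \<and>
             (\<forall>i<n. (\<Oplus>\<^bsub>M\<^esub>j\<in>{..<k}. r i j \<odot>\<^bsub>M\<^esub> y j) = a i)) \<longrightarrow>
        (\<exists>x. (\<forall>j<k. x j \<in> A) \<and>
             (\<forall>i<n. (\<Oplus>\<^bsub>M\<^esub>j\<in>{..<k}. r i j \<odot>\<^bsub>M\<^esub> x j) = a i)))"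

definition pure_essential ::
    "('a, 'b) ring_scheme \<Rightarrow> ('a, 'm, 'c) module_scheme \<Rightarrow> 'm set \<Rightarrow> bool" where
  "pure_essential R B A \<longleftrightarrow> pure_submodule R B A \<and>
     (\<forall>Y. submodule Y R B \<longrightarrow> Y \<inter> A = {\<zero>\<^bsub>B\<^esub>} \<longrightarrow>
          pure_submodule R (quot_module B Y) (quot_image B Y (Y <+>\<^bsub>B\<^esub> A)) \<longrightarrow>
          Y = {\<zero>\<^bsub>B\<^esub>})"

end

theory Submission
  imports Defs
begin

text \<open>
  Suppose that \<open>R\<close> has a chain of three primes. Then there are a nonzero nonunit \<open>f\<close> and a nonzero \<open>g\<close>
  dividing no power of \<open>f\<close>, and with \<open>h = f g\<close> the flat modules \<open>R[1/f]\<close> and \<open>R[1/h]\<close> are different. From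
  them three modules \<open>A \<subseteq> B \<subseteq> C\<close> are built for which transitivity fails.

  Let \<open>D\<close> consist of the sequences \<open>s\<close> in \<open>R\<close> with \<open>s k = w h^k\<close> for large \<open>k\<close>, where \<open>w\<close> is in \<open>R[1/h]\<close>. It is
  an extension of \<open>R[1/h]\<close> by the free module \<open>A\<close> of finitely supported sequences. Let \<open>B\<close> be the
  submodule \<open>w \<in> R[1/f]\<close>, an extension of \<open>R[1/f]\<close> by \<open>A\<close>. Finally let
  \<open>C = {(s, v). s \<in> D, v \<in> R[1/h], w - v \<in> R[1/f]}\<close>, which contains \<open>B\<close> as the submodule \<open>v = 0\<close> and is an
  extension of \<open>R[1/h]\<close> by \<open>B\<close>.

  An extension of a nonzero rank one torsion-free module by a torsion-free module is pure-essential as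
  soon as it is pure and does not split: if \<open>Y \<noteq> 0\<close> meets the small module trivially, the quotient of the
  large module by \<open>Y\<close> is a torsion extension of the small one, and purity yields a retraction. The
  two extensions do not split because no nonzero element of \<open>D\<close> is divisible by all powers of \<open>f\<close>, by
  Krull's intersection theorem, and because \<open>1/h\<close> is not in \<open>R[1/f]\<close>. The lemmas
  \<open>pure_essential_A_B\<close> and \<open>pure_essential_B_C\<close> carry this out elementwise, using \<open>divide_if_pure_in_quot\<close> and
  \<open>zero_if_infinitely_divisible\<close>; purity itself comes from \<open>pure_submodule_if_locally_retract\<close>.

  The extension \<open>A \<subseteq> C\<close> is not pure-essential. The submodule \<open>X\<close> given by \<open>s = 0\<close> is a copy of \<open>R[1/f]\<close>, it
  meets even \<open>B\<close> trivially, and \<open>C/X\<close> is \<open>D\<close>, in which the finitely supported sequences are pure because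
  a system with right-hand sides in \<open>A\<close> can be truncated (\<open>pure_A_quot_X\<close>).

  All elements of \<open>C\<close> are described by finite lists over \<open>R\<close>. As \<open>R\<close> is infinite, \<open>C\<close> can be realised in
  every type that contains a copy of \<open>R\<close> (\<open>ex_model\<close>). To avoid fractions, an element of \<open>R[1/h]\<close> is
  represented by a sequence that is eventually geometric with ratio \<open>h\<close>, up to finitely many terms.
\<close>

section \<open>Linear maps, image modules and quotients\<close>

definition linear_maps ::
    "('a, 'b) ring_scheme \<Rightarrow> ('a, 'm, 'c) module_scheme \<Rightarrow> ('a, 'n, 'd) module_scheme \<Rightarrow> ('m \<Rightarrow> 'n) set"
  where "linear_maps R M C = {\<phi>. \<phi> \<in> carrier M \<rightarrow> carrier C \<and>
     (\<forall>x\<in>carrier M. \<forall>y\<in>carrier M. \<phi> (x \<oplus>\<^bsub>M\<^esub> y) = \<phi> x \<oplus>\<^bsub>C\<^esub> \<phi> y) \<and>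
     (\<forall>r\<in>carrier R. \<forall>x\<in>carrier M. \<phi> (r \<odot>\<^bsub>M\<^esub> x) = r \<odot>\<^bsub>C\<^esub> \<phi> x)}"

lemma linear_mapsI:
  assumes "\<And>x. x \<in> carrier M \<Longrightarrow> \<phi> x \<in> carrier C"
    and "\<And>x y. x \<in> carrier M \<Longrightarrow> y \<in> carrier M \<Longrightarrow> \<phi> (x \<oplus>\<^bsub>M\<^esub> y) = \<phi> x \<oplus>\<^bsub>C\<^esub> \<phi> y"
    and "\<And>r x. r \<in> carrier R \<Longrightarrow> x \<in> carrier M \<Longrightarrow> \<phi> (r \<odot>\<^bsub>M\<^esub> x) = r \<odot>\<^bsub>C\<^esub> \<phi> x"
  shows "\<phi> \<in> linear_maps R M C"
  using assms by (auto simp: linear_maps_def)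

lemma linear_mapsD:
  assumes "\<phi> \<in> linear_maps R M C"
  shows "x \<in> carrier M \<Longrightarrow> \<phi> x \<in> carrier C"
    and "x \<in> carrier M \<Longrightarrow> y \<in> carrier M \<Longrightarrow> \<phi> (x \<oplus>\<^bsub>M\<^esub> y) = \<phi> x \<oplus>\<^bsub>C\<^esub> \<phi> y"
    and "r \<in> carrier R \<Longrightarrow> x \<in> carrier M \<Longrightarrow> \<phi> (r \<odot>\<^bsub>M\<^esub> x) = r \<odot>\<^bsub>C\<^esub> \<phi> x"
  using assms by (auto simp: linear_maps_def)

lemma linear_maps_comp:
  assumes "\<phi> \<in> linear_maps R M C" "\<psi> \<in> linear_maps R C D"
  shows "(\<lambda>x. \<psi> (\<phi> x)) \<in> linear_maps R M D"
  by (rule linear_mapsI) (simp_all add: linear_mapsD[OF assms(1)] linear_mapsD[OF assms(2)])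

text \<open>
  The laws of a module pass to a surjective image, which is how both quotients and copies of a
  module in another type are recognised as modules.
\<close>

lemma module_surj_image:
  assumes M: "module R M" and \<phi>: "\<phi> \<in> linear_maps R M C"
    and surj: "\<phi> ` carrier M = carrier C" and zero: "\<phi> \<zero>\<^bsub>M\<^esub> = \<zero>\<^bsub>C\<^esub>"
  shows "module R C"
proof -
  interpret M: module R M by fact
  note hom = linear_mapsD[OF \<phi>]
  have rep: "\<exists>y\<in>carrier M. x = \<phi> y" if "x \<in> carrier C" for x
    using that surj by auto
  have add: "x \<oplus>\<^bsub>C\<^esub> y \<in> carrier C" if "x \<in> carrier C" "y \<in> carrier C" for x y
    using rep[OF that(1)] rep[OF that(2)] hom(1,2) by (metis M.M.add.m_closed)
  have "abelian_group C"
  proof (rule abelian_groupI)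
    show "\<zero>\<^bsub>C\<^esub> \<in> carrier C" using zero hom(1)[OF M.M.zero_closed] by simp
  next
    fix x y z assume xyz: "x \<in> carrier C" "y \<in> carrier C" "z \<in> carrier C"
    obtain x' y' z' where "x' \<in> carrier M" "y' \<in> carrier M" "z' \<in> carrier M"
      and "x = \<phi> x'" "y = \<phi> y'" "z = \<phi> z'"
      using rep[OF xyz(1)] rep[OF xyz(2)] rep[OF xyz(3)] by blast
    then show "x \<oplus>\<^bsub>C\<^esub> y \<oplus>\<^bsub>C\<^esub> z = x \<oplus>\<^bsub>C\<^esub> (y \<oplus>\<^bsub>C\<^esub> z)"
      by (simp flip: hom(2) add: M.M.a_assoc)
  next
    fix x y assume xy: "x \<in> carrier C" "y \<in> carrier C"
    obtain x' y' where "x' \<in> carrier M" "y' \<in> carrier M" and "x = \<phi> x'" "y = \<phi> y'"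
      using rep[OF xy(1)] rep[OF xy(2)] by blast
    then show "x \<oplus>\<^bsub>C\<^esub> y = y \<oplus>\<^bsub>C\<^esub> x"
      by (simp flip: hom(2) add: M.M.a_comm)
  next
    fix x assume "x \<in> carrier C"
    then obtain x' where *: "x' \<in> carrier M" "x = \<phi> x'" using rep by blast
    then show "\<zero>\<^bsub>C\<^esub> \<oplus>\<^bsub>C\<^esub> x = x"
      by (simp flip: hom(2) zero)
    have "\<phi> (\<ominus>\<^bsub>M\<^esub> x') \<oplus>\<^bsub>C\<^esub> x = \<zero>\<^bsub>C\<^esub>"
      using * by (simp flip: hom(2) add: M.M.l_neg zero)
    then show "\<exists>y\<in>carrier C. y \<oplus>\<^bsub>C\<^esub> x = \<zero>\<^bsub>C\<^esub>"
      using * hom(1) by blast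
  qed (rule add)
  then show ?thesis
  proof (rule moduleI[OF M.R.is_cring])
    fix a x assume "a \<in> carrier R" "x \<in> carrier C"
    then show "a \<odot>\<^bsub>C\<^esub> x \<in> carrier C"
      using rep hom(1,3) by (metis M.smult_closed)
  next
    fix a x y assume a: "a \<in> carrier R" and xy: "x \<in> carrier C" "y \<in> carrier C"
    obtain x' y' where "x' \<in> carrier M" "y' \<in> carrier M" and "x = \<phi> x'" "y = \<phi> y'"
      using rep[OF xy(1)] rep[OF xy(2)] by blast
    then show "a \<odot>\<^bsub>C\<^esub> (x \<oplus>\<^bsub>C\<^esub> y) = a \<odot>\<^bsub>C\<^esub> x \<oplus>\<^bsub>C\<^esub> a \<odot>\<^bsub>C\<^esub> y"
      using a by (simp flip: hom(2,3) add: M.smult_r_distr)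
  next
    fix a b x assume ab: "a \<in> carrier R" "b \<in> carrier R" and "x \<in> carrier C"
    then obtain x' where *: "x' \<in> carrier M" "x = \<phi> x'" using rep by blast
    then show "(a \<oplus>\<^bsub>R\<^esub> b) \<odot>\<^bsub>C\<^esub> x = a \<odot>\<^bsub>C\<^esub> x \<oplus>\<^bsub>C\<^esub> b \<odot>\<^bsub>C\<^esub> x"
      and "a \<otimes>\<^bsub>R\<^esub> b \<odot>\<^bsub>C\<^esub> x = a \<odot>\<^bsub>C\<^esub> (b \<odot>\<^bsub>C\<^esub> x)"
      using ab by (simp_all flip: hom(2,3) add: M.smult_l_distr M.smult_assoc1)
  next
    fix x assume "x \<in> carrier C"
    then obtain x' where "x' \<in> carrier M" "x = \<phi> x'" using rep by blast
    then show "\<one>\<^bsub>R\<^esub> \<odot>\<^bsub>C\<^esub> x = x" by (simp flip: hom(3))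
  qed
qed

text \<open>
  The map \<open>\<phi>\<close> only has to identify elements compatibly with the operations; its values serve as names
  for the classes. In this way a quotient module is formed directly in a prescribed type.
\<close>

definition image_module :: "('a, 'm, 'c) module_scheme \<Rightarrow> ('m \<Rightarrow> 'n) \<Rightarrow> ('a, 'n) module" where
  "image_module M \<phi> =
     (let \<psi> = inv_into (carrier M) \<phi> in
      \<lparr>carrier = \<phi> ` carrier M, monoid.mult = undefined, one = undefined, zero = \<phi> \<zero>\<^bsub>M\<^esub>,
       add = (\<lambda>c d. \<phi> (\<psi> c \<oplus>\<^bsub>M\<^esub> \<psi> d)), smult = (\<lambda>r c. \<phi> (r \<odot>\<^bsub>M\<^esub> \<psi> c))\<rparr>)"

lemma
  assumes M: "module R M"
    and add: "\<And>x x' y y'. \<lbrakk>x \<in> carrier M; x' \<in> carrier M; y \<in> carrier M; y' \<in> carrier M;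
        \<phi> x = \<phi> x'; \<phi> y = \<phi> y'\<rbrakk> \<Longrightarrow> \<phi> (x \<oplus>\<^bsub>M\<^esub> y) = \<phi> (x' \<oplus>\<^bsub>M\<^esub> y')"
    and smult: "\<And>r x x'. \<lbrakk>r \<in> carrier R; x \<in> carrier M; x' \<in> carrier M; \<phi> x = \<phi> x'\<rbrakk>
        \<Longrightarrow> \<phi> (r \<odot>\<^bsub>M\<^esub> x) = \<phi> (r \<odot>\<^bsub>M\<^esub> x')"
  shows image_module_proj: "\<phi> \<in> linear_maps R M (image_module M \<phi>)"
    and module_image_module: "module R (image_module M \<phi>)"
proof -
  have \<psi>: "inv_into (carrier M) \<phi> (\<phi> x) \<in> carrier M"
      "\<phi> (inv_into (carrier M) \<phi> (\<phi> x)) = \<phi> x" if "x \<in> carrier M" for x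
    using that by (auto intro: inv_into_into f_inv_into_f)
  show hom: "\<phi> \<in> linear_maps R M (image_module M \<phi>)"
    by (rule linear_mapsI) (auto simp: image_module_def Let_def \<psi> intro!: add smult)
  show "module R (image_module M \<phi>)"
    by (rule module_surj_image[OF M hom]) (simp_all add: image_module_def Let_def)
qed

lemma (in abelian_group) minus_eq_zero_iff:
  assumes "x \<in> carrier G" "y \<in> carrier G"
  shows "x \<ominus> y = \<zero> \<longleftrightarrow> x = y"
proof
  assume "x \<ominus> y = \<zero>"
  moreover have "(x \<ominus> y) \<oplus> y = x" using assms by (simp add: minus_eq a_assoc l_neg)
  ultimately show "x = y" using assms by simp
qed (use assms in \<open>simp add: minus_eq r_neg\<close>)

lemma linear_maps_zero:
  assumes "module R M" "module R C" "\<phi> \<in> linear_maps R M C"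
  shows "\<phi> \<zero>\<^bsub>M\<^esub> = \<zero>\<^bsub>C\<^esub>"
proof -
  interpret M: module R M by fact
  interpret C: module R C by fact
  have "\<phi> (\<zero>\<^bsub>R\<^esub> \<odot>\<^bsub>M\<^esub> \<zero>\<^bsub>M\<^esub>) = \<zero>\<^bsub>R\<^esub> \<odot>\<^bsub>C\<^esub> \<phi> \<zero>\<^bsub>M\<^esub>"
    by (rule linear_mapsD(3)[OF assms(3)]) auto
  then show ?thesis
    using linear_mapsD(1)[OF assms(3) M.M.zero_closed] by simp
qed

lemma linear_maps_minus:
  assumes "module R M" "module R C" "\<phi> \<in> linear_maps R M C" "x \<in> carrier M" "y \<in> carrier M"
  shows "\<phi> (x \<ominus>\<^bsub>M\<^esub> y) = \<phi> x \<ominus>\<^bsub>C\<^esub> \<phi> y"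
proof -
  interpret M: module R M by fact
  interpret C: module R C by fact
  have "\<phi> (x \<oplus>\<^bsub>M\<^esub> (\<ominus>\<^bsub>R\<^esub> \<one>\<^bsub>R\<^esub>) \<odot>\<^bsub>M\<^esub> y) = \<phi> x \<oplus>\<^bsub>C\<^esub> (\<ominus>\<^bsub>R\<^esub> \<one>\<^bsub>R\<^esub>) \<odot>\<^bsub>C\<^esub> \<phi> y"
    using assms(4,5) by (simp add: linear_mapsD[OF assms(3)])
  then show ?thesis
    using assms(4,5) linear_mapsD(1)[OF assms(3)]
    by (simp add: M.smult_l_minus C.smult_l_minus M.M.minus_eq C.M.minus_eq)
qed

lemma linear_maps_lincomb:
  fixes r :: "nat \<Rightarrow> 'a"
  assumes M: "module R M" and C: "module R C" and \<phi>: "\<phi> \<in> linear_maps R M C"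
    and "\<And>j. j < k \<Longrightarrow> r j \<in> carrier R" "\<And>j. j < k \<Longrightarrow> y j \<in> carrier M"
  shows "\<phi> (\<Oplus>\<^bsub>M\<^esub>j\<in>{..<k}. r j \<odot>\<^bsub>M\<^esub> y j) = (\<Oplus>\<^bsub>C\<^esub>j\<in>{..<k}. r j \<odot>\<^bsub>C\<^esub> \<phi> (y j))"
  using assms(4,5)
proof (induction k)
  case 0
  interpret M: module R M by fact
  interpret C: module R C by fact
  show ?case using linear_maps_zero[OF M C \<phi>] by simp
next
  case (Suc k)
  interpret M: module R M by fact
  interpret C: module R C by fact
  have "(\<Oplus>\<^bsub>M\<^esub>j\<in>{..<k}. r j \<odot>\<^bsub>M\<^esub> y j) \<in> carrier M"
    using Suc.prems by (auto intro!: M.M.finsum_closed)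
  then show ?case
    using Suc linear_mapsD(1)[OF \<phi>]
    by (simp add: lessThan_Suc linear_mapsD(2,3)[OF \<phi>] Pi_def)
qed

lemma (in module) submodule_if_closed:
  assumes "H \<subseteq> carrier M" "\<zero>\<^bsub>M\<^esub> \<in> H" "\<And>a b. a \<in> H \<Longrightarrow> b \<in> H \<Longrightarrow> a \<oplus>\<^bsub>M\<^esub> b \<in> H"
    "\<And>a x. a \<in> carrier R \<Longrightarrow> x \<in> H \<Longrightarrow> a \<odot>\<^bsub>M\<^esub> x \<in> H"
  shows "submodule H R M"
proof (rule submoduleI[OF assms(1,2) _ assms(3,4)])
  fix a assume "a \<in> H"
  then have "(\<ominus> \<one>) \<odot>\<^bsub>M\<^esub> a \<in> H" "a \<in> carrier M" using assms by auto
  then show "\<ominus>\<^bsub>M\<^esub> a \<in> H" by (simp add: smult_l_minus)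
qed

lemma (in module) submodule_zero:
  assumes "submodule H R M" shows "\<zero>\<^bsub>M\<^esub> \<in> H"
  using subgroup.one_closed[OF submodule.axioms(1)[OF assms]] by simp

lemma sublinear_maps_image:
  assumes M: "module R M" and C: "module R C" and \<phi>: "\<phi> \<in> linear_maps R M C"
    and S: "submodule S R M"
  shows "submodule (\<phi> ` S) R C"
proof -
  interpret M: module R M by fact
  interpret C: module R C by fact
  note hom = linear_mapsD[OF \<phi>] and E = M.submoduleE[OF S]
  have SM: "x \<in> carrier M" if "x \<in> S" for x using E(1) that by auto
  show ?thesis
  proof (rule C.submodule_if_closed)
    show "\<zero>\<^bsub>C\<^esub> \<in> \<phi> ` S"
      using M.submodule_zero[OF S] linear_maps_zero[OF M C \<phi>] by force
  next
    fix a b assume "a \<in> \<phi> ` S" "b \<in> \<phi> ` S"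
    then show "a \<oplus>\<^bsub>C\<^esub> b \<in> \<phi> ` S"
      by (auto simp flip: hom(2) intro!: imageI E simp: SM)
  next
    fix a b assume "a \<in> carrier R" "b \<in> \<phi> ` S"
    then show "a \<odot>\<^bsub>C\<^esub> b \<in> \<phi> ` S"
      by (auto simp flip: hom(3) intro!: imageI E simp: SM)
  qed (use hom(1) SM in auto)
qed

lemma submodule_restrict:
  assumes "module R M" "submodule S R M" "submodule T R M" "S \<subseteq> T"
  shows "submodule S R (M\<lparr>carrier := T\<rparr>)"
proof -
  interpret M: module R M by fact
  interpret T: module R "M\<lparr>carrier := T\<rparr>"
    using submodule.submodule_is_module[OF assms(3,1)] .
  note E = M.submoduleE[OF assms(2)] and Z = M.submodule_zero[OF assms(2)]
  show ?thesis
    by (rule T.submodule_if_closed) (use E Z assms(4) in auto)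
qed

lemma
  assumes M: "module R M" and Y: "submodule Y R M"
  shows module_quot_module: "module R (quot_module M Y)"
    and quot_module_proj: "(\<lambda>x. Y +>\<^bsub>M\<^esub> x) \<in> linear_maps R M (quot_module M Y)"
    and quot_module_surj: "(\<lambda>x. Y +>\<^bsub>M\<^esub> x) ` carrier M = carrier (quot_module M Y)"
    and quot_module_ker:
      "x \<in> carrier M \<Longrightarrow> Y +>\<^bsub>M\<^esub> x = \<zero>\<^bsub>quot_module M Y\<^esub> \<longleftrightarrow> x \<in> Y"
proof -
  interpret M: module R M by fact
  note E = M.submoduleE[OF Y] and Y0 = M.submodule_zero[OF Y]
  have YM: "x \<in> carrier M" if "x \<in> Y" for x using E(1) that by auto
  have sub: "subgroup Y (add_monoid M)" using submodule.axioms(1)[OF Y] .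
  interpret Y: abelian_subgroup Y M
    by (rule abelian_subgroupI3[OF additive_subgroup.intro[OF sub]]) (rule M.M.abelian_group_axioms)
  show surj: "(\<lambda>x. Y +>\<^bsub>M\<^esub> x) ` carrier M = carrier (quot_module M Y)"
    by (auto simp: quot_module_def A_RCOSETS_def')
  show hom: "(\<lambda>x. Y +>\<^bsub>M\<^esub> x) \<in> linear_maps R M (quot_module M Y)"
  proof (rule linear_mapsI)
    fix r x assume r: "r \<in> carrier R" and x: "x \<in> carrier M"
    have "Y +>\<^bsub>M\<^esub> (r \<odot>\<^bsub>M\<^esub> x) = Y <+>\<^bsub>M\<^esub> ((\<lambda>s. r \<odot>\<^bsub>M\<^esub> s) ` (Y +>\<^bsub>M\<^esub> x))"
    proof (intro equalityI subsetI)
      fix v assume "v \<in> Y +>\<^bsub>M\<^esub> (r \<odot>\<^bsub>M\<^esub> x)"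
      then obtain y where "y \<in> Y" "v = y \<oplus>\<^bsub>M\<^esub> r \<odot>\<^bsub>M\<^esub> x" by (auto simp: a_r_coset_def')
      then show "v \<in> Y <+>\<^bsub>M\<^esub> ((\<lambda>s. r \<odot>\<^bsub>M\<^esub> s) ` (Y +>\<^bsub>M\<^esub> x))"
        using Y.a_rcos_self[OF x] by (auto simp: set_add_def')
    next
      fix v assume "v \<in> Y <+>\<^bsub>M\<^esub> ((\<lambda>s. r \<odot>\<^bsub>M\<^esub> s) ` (Y +>\<^bsub>M\<^esub> x))"
      then obtain y y' where y: "y \<in> Y" "y' \<in> Y" "v = y \<oplus>\<^bsub>M\<^esub> r \<odot>\<^bsub>M\<^esub> (y' \<oplus>\<^bsub>M\<^esub> x)"
        by (auto simp: set_add_def' a_r_coset_def')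
      then have "v = (y \<oplus>\<^bsub>M\<^esub> r \<odot>\<^bsub>M\<^esub> y') \<oplus>\<^bsub>M\<^esub> r \<odot>\<^bsub>M\<^esub> x"
        using r x YM by (simp add: M.smult_r_distr M.M.a_assoc)
      moreover have "y \<oplus>\<^bsub>M\<^esub> r \<odot>\<^bsub>M\<^esub> y' \<in> Y" using y r E by simp
      ultimately show "v \<in> Y +>\<^bsub>M\<^esub> (r \<odot>\<^bsub>M\<^esub> x)" by (auto simp: a_r_coset_def')
    qed
    then show "Y +>\<^bsub>M\<^esub> (r \<odot>\<^bsub>M\<^esub> x) = r \<odot>\<^bsub>quot_module M Y\<^esub> (Y +>\<^bsub>M\<^esub> x)"
      by (simp add: quot_module_def)
  next
    fix x y assume "x \<in> carrier M" "y \<in> carrier M"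
    then show "Y +>\<^bsub>M\<^esub> (x \<oplus>\<^bsub>M\<^esub> y) = (Y +>\<^bsub>M\<^esub> x) \<oplus>\<^bsub>quot_module M Y\<^esub> (Y +>\<^bsub>M\<^esub> y)"
      using Y.a_rcos_sum by (simp add: quot_module_def)
  qed (use surj in blast)
  have zero: "x \<in> carrier M \<Longrightarrow> Y +>\<^bsub>M\<^esub> x = \<zero>\<^bsub>quot_module M Y\<^esub> \<longleftrightarrow> x \<in> Y" for x
    using M.M.a_coset_join1[OF _ _ sub] M.M.a_coset_join2[OF _ sub] by (auto simp: quot_module_def)
  then show "x \<in> carrier M \<Longrightarrow> Y +>\<^bsub>M\<^esub> x = \<zero>\<^bsub>quot_module M Y\<^esub> \<longleftrightarrow> x \<in> Y" .
  show "module R (quot_module M Y)"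
    by (rule module_surj_image[OF M hom surj]) (use zero Y0 in simp)
qed

lemma quot_image_sum:
  assumes M: "module R M" and Y: "submodule Y R M" and A: "submodule A R M"
  shows "quot_image M Y (Y <+>\<^bsub>M\<^esub> A) = (\<lambda>x. Y +>\<^bsub>M\<^esub> x) ` A"
proof -
  interpret M: module R M by fact
  interpret Q: module R "quot_module M Y" using module_quot_module[OF M Y] .
  note \<pi> = linear_mapsD[OF quot_module_proj[OF M Y]] and ker = quot_module_ker[OF M Y]
  have YM: "x \<in> carrier M" if "x \<in> Y" for x using M.submoduleE(1)[OF Y] that by auto
  have AM: "x \<in> carrier M" if "x \<in> A" for x using M.submoduleE(1)[OF A] that by auto
  have "Y +>\<^bsub>M\<^esub> (y \<oplus>\<^bsub>M\<^esub> a) = Y +>\<^bsub>M\<^esub> a" if "y \<in> Y" "a \<in> A" for y a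
    using that YM AM by (simp add: \<pi> ker[THEN iffD2])
  moreover have "a \<in> Y <+>\<^bsub>M\<^esub> A" if "a \<in> A" for a
    using that AM M.submodule_zero[OF Y] by (force simp: set_add_def')
  ultimately show ?thesis
    by (auto simp: quot_image_def set_add_def' image_iff)
qed

section \<open>Two criteria for purity\<close>

text \<open>
  A direct summand is pure because a retraction carries solutions into it. A system has only finitely
  many equations, so a retraction that depends on the system is enough. Here the system in \<open>C\<close> is lifted
  to \<open>M\<close>, where it holds up to errors in the kernel of \<open>\<phi>\<close>; the map \<open>\<tau>\<close> has to kill those errors (the
  set \<open>W\<close>) and to fix the right-hand sides (the set \<open>E\<close>), in both cases after applying \<open>\<phi>\<close>.
\<close>

lemma pure_submodule_if_locally_retract:
  assumes M: "module R M" and C: "module R C" and \<phi>: "\<phi> \<in> linear_maps R M C"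
    and surj: "\<phi> ` carrier M = carrier C" and S: "submodule S R M" "submodule (\<phi> ` S) R C"
    and retract: "\<And>W E. finite W \<Longrightarrow> finite E \<Longrightarrow> W \<subseteq> {w \<in> carrier M. \<phi> w = \<zero>\<^bsub>C\<^esub>} \<Longrightarrow> E \<subseteq> S \<Longrightarrow>
      \<exists>\<tau> \<in> linear_maps R M M. \<tau> ` carrier M \<subseteq> S \<and> (\<forall>w\<in>W. \<phi> (\<tau> w) = \<zero>\<^bsub>C\<^esub>) \<and> (\<forall>a\<in>E. \<phi> (\<tau> a) = \<phi> a)"
  shows "pure_submodule R C (\<phi> ` S)"
  unfolding pure_submodule_def
proof (intro conjI allI impI)
  interpret M: module R M by fact
  interpret C: module R C by fact
  note hom = linear_mapsD[OF \<phi>]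
  have SM: "x \<in> carrier M" if "x \<in> S" for x using M.submoduleE(1)[OF S(1)] that by auto
  show "submodule (\<phi> ` S) R C" by fact
  fix n k :: nat and r a
  assume r: "\<forall>i<n. \<forall>j<k. r i j \<in> carrier R" and a: "\<forall>i<n. a i \<in> \<phi> ` S"
    and "\<exists>y. (\<forall>j<k. y j \<in> carrier C) \<and> (\<forall>i<n. (\<Oplus>\<^bsub>C\<^esub>j\<in>{..<k}. r i j \<odot>\<^bsub>C\<^esub> y j) = a i)"
  then obtain y where y: "\<forall>j<k. y j \<in> \<phi> ` carrier M"
    and eq: "\<forall>i<n. (\<Oplus>\<^bsub>C\<^esub>j\<in>{..<k}. r i j \<odot>\<^bsub>C\<^esub> y j) = a i" unfolding surj by blast
  from y obtain y' where y': "\<And>j. j < k \<Longrightarrow> y' j \<in> carrier M" "\<And>j. j < k \<Longrightarrow> y j = \<phi> (y' j)"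
    unfolding image_iff by metis
  from a obtain a' where a': "\<And>i. i < n \<Longrightarrow> a' i \<in> S" "\<And>i. i < n \<Longrightarrow> a i = \<phi> (a' i)"
    unfolding image_iff by metis
  define l where "l i = (\<Oplus>\<^bsub>M\<^esub>j\<in>{..<k}. r i j \<odot>\<^bsub>M\<^esub> y' j)" for i
  have l: "l i \<in> carrier M" if "i < n" for i
    unfolding l_def using r y' that by (auto intro!: M.M.finsum_closed)
  have "\<phi> (l i) = (\<Oplus>\<^bsub>C\<^esub>j\<in>{..<k}. r i j \<odot>\<^bsub>C\<^esub> \<phi> (y' j))" if "i < n" for i
    unfolding l_def using r y' that by (intro linear_maps_lincomb[OF M C \<phi>]) auto
  also have "\<dots> i = (\<Oplus>\<^bsub>C\<^esub>j\<in>{..<k}. r i j \<odot>\<^bsub>C\<^esub> y j)" if "i < n" for i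
    using r y' that hom(1) by (intro C.M.finsum_cong') auto
  finally have \<phi>l: "\<phi> (l i) = \<phi> (a' i)" if "i < n" for i using that eq a' by simp
  define w where "w i = l i \<ominus>\<^bsub>M\<^esub> a' i" for i
  have w: "w i \<in> carrier M" "\<phi> (w i) = \<zero>\<^bsub>C\<^esub>" if "i < n" for i
    using that l a' SM \<phi>l hom(1)
    by (simp_all add: w_def linear_maps_minus[OF M C \<phi>] C.M.minus_eq C.M.r_neg)
  have lw: "l i = w i \<oplus>\<^bsub>M\<^esub> a' i" if "i < n" for i
    using that l a' SM by (simp add: w_def M.M.minus_eq M.M.a_assoc M.M.l_neg)
  obtain \<tau> where \<tau>: "\<tau> \<in> linear_maps R M M" "\<tau> ` carrier M \<subseteq> S"
    "\<And>i. i < n \<Longrightarrow> \<phi> (\<tau> (w i)) = \<zero>\<^bsub>C\<^esub>" "\<And>i. i < n \<Longrightarrow> \<phi> (\<tau> (a' i)) = \<phi> (a' i)"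
  proof -
    have "w ` {..<n} \<subseteq> {w \<in> carrier M. \<phi> w = \<zero>\<^bsub>C\<^esub>}" "a' ` {..<n} \<subseteq> S"
      using w a' by auto
    from retract[OF _ _ this] that show ?thesis by auto
  qed
  note \<tau>h = linear_mapsD[OF \<tau>(1)]
  show "\<exists>x. (\<forall>j<k. x j \<in> \<phi> ` S) \<and> (\<forall>i<n. (\<Oplus>\<^bsub>C\<^esub>j\<in>{..<k}. r i j \<odot>\<^bsub>C\<^esub> x j) = a i)"
  proof (intro exI[of _ "\<lambda>j. \<phi> (\<tau> (y' j))"] conjI allI impI)
    fix i assume i: "i < n"
    have "(\<Oplus>\<^bsub>C\<^esub>j\<in>{..<k}. r i j \<odot>\<^bsub>C\<^esub> \<phi> (\<tau> (y' j))) = \<phi> (\<tau> (l i))"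
      unfolding l_def using r y' i
      by (intro linear_maps_lincomb[OF M C linear_maps_comp[OF \<tau>(1) \<phi>], symmetric]) auto
    also have "\<dots> = \<phi> (\<tau> (w i)) \<oplus>\<^bsub>C\<^esub> \<phi> (\<tau> (a' i))"
      using lw[OF i] w[OF i] a'(1)[OF i] SM by (simp add: \<tau>h hom)
    also have "\<dots> = a i"
      using \<tau>(3,4)[OF i] a'[OF i] SM hom(1) by simp
    finally show "(\<Oplus>\<^bsub>C\<^esub>j\<in>{..<k}. r i j \<odot>\<^bsub>C\<^esub> \<phi> (\<tau> (y' j))) = a i" .
  next
    fix j assume "j < k"
    then show "\<phi> (\<tau> (y' j)) \<in> \<phi> ` S" using y'(1) \<tau>(2) by blast
  qed
qed

text \<open>
  Both proofs of essentiality use purity in the quotient only for one equation in one unknown: the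
  summand \<open>y\<close> vanishes modulo \<open>Y\<close>, so \<open>a\<close> becomes divisible by \<open>q\<close>, and \<open>Y \<inter> A = {0}\<close> turns the resulting
  congruence modulo \<open>Y\<close> into an equality.
\<close>

lemma divide_if_pure_in_quot:
  assumes M: "module R M" and Y: "submodule Y R M" and A: "submodule A R M"
    and disj: "Y \<inter> A = {\<zero>\<^bsub>M\<^esub>}"
    and pure: "pure_submodule R (quot_module M Y) (quot_image M Y (Y <+>\<^bsub>M\<^esub> A))"
    and q: "q \<in> carrier R" and c: "c \<in> carrier M" 
    and a: "a \<in> A" and y: "y \<in> Y" "q \<odot>\<^bsub>M\<^esub> c = y \<oplus>\<^bsub>M\<^esub> a"
  shows "\<exists>z\<in>A. q \<odot>\<^bsub>M\<^esub> z = a"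
proof -
  interpret M: module R M by fact
  have Q: "module R (quot_module M Y)" using module_quot_module[OF M Y] .
  interpret Q: module R "quot_module M Y" by fact
  define \<pi> where "\<pi> x = Y +>\<^bsub>M\<^esub> x" for x
  have \<pi>: "\<pi> \<in> linear_maps R M (quot_module M Y)"
    using quot_module_proj[OF M Y] by (simp add: \<pi>_def[abs_def])
  note hom = linear_mapsD[OF \<pi>]
  have eq: "x \<ominus>\<^bsub>M\<^esub> y \<in> Y \<longleftrightarrow> \<pi> x = \<pi> y" if "x \<in> carrier M" "y \<in> carrier M" for x y
    using that quot_module_ker[OF M Y, of "x \<ominus>\<^bsub>M\<^esub> y"] linear_maps_minus[OF M Q \<pi>] hom(1)
    by (simp flip: \<pi>_def add: Q.M.minus_eq_zero_iff)
  have AM: "x \<in> carrier M" if "x \<in> A" for x using M.submoduleE(1)[OF A] that by auto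
  have YM: "x \<in> carrier M" if "x \<in> Y" for x using M.submoduleE(1)[OF Y] that by auto
  have 1: "(\<Oplus>\<^bsub>quot_module M Y\<^esub>j\<in>{..<Suc 0}. q \<odot>\<^bsub>quot_module M Y\<^esub> x j) = q \<odot>\<^bsub>quot_module M Y\<^esub> x 0"
    if "x 0 \<in> carrier (quot_module M Y)" for x :: "nat \<Rightarrow> _"
    using that q by (simp add: lessThan_Suc)
  have img: "quot_image M Y (Y <+>\<^bsub>M\<^esub> A) = \<pi> ` A"
    using quot_image_sum[OF M Y A] by (simp add: \<pi>_def[abs_def])
  have "q \<odot>\<^bsub>quot_module M Y\<^esub> \<pi> c = \<pi> a"
    using q c a AM y YM hom(1) quot_module_ker[OF M Y, of y] by (simp flip: hom(3) \<pi>_def add: hom(2))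
  then have "\<forall>i<Suc 0. (\<Oplus>\<^bsub>quot_module M Y\<^esub>j\<in>{..<Suc 0}. q \<odot>\<^bsub>quot_module M Y\<^esub> \<pi> c) = \<pi> a"
    using 1[of "\<lambda>_. \<pi> c"] c hom(1) by simp
  then have "\<exists>y. (\<forall>j<Suc 0. y j \<in> carrier (quot_module M Y)) \<and>
     (\<forall>i<Suc 0. (\<Oplus>\<^bsub>quot_module M Y\<^esub>j\<in>{..<Suc 0}. q \<odot>\<^bsub>quot_module M Y\<^esub> y j) = \<pi> a)"
    using c hom(1) by (intro exI[of _ "\<lambda>_. \<pi> c"]) simp
  from pure[unfolded img pure_submodule_def, THEN conjunct2, THEN spec[of _ "Suc 0"],
      THEN spec[of _ "Suc 0"], THEN spec[of _ "\<lambda>_ _. q"], THEN spec[of _ "\<lambda>_. \<pi> a"],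
      THEN mp, THEN mp, THEN mp, OF _ _ this]
  obtain x where "\<forall>j<Suc 0. x j \<in> \<pi> ` A" and
    "\<forall>i<Suc 0. (\<Oplus>\<^bsub>quot_module M Y\<^esub>j\<in>{..<Suc 0}. q \<odot>\<^bsub>quot_module M Y\<^esub> x j) = \<pi> a"
    using q a by auto
  then have x: "x 0 \<in> \<pi> ` A"
    "(\<Oplus>\<^bsub>quot_module M Y\<^esub>j\<in>{..<Suc 0}. q \<odot>\<^bsub>quot_module M Y\<^esub> x j) = \<pi> a" by blast+
  then obtain z where z: "z \<in> A" "x 0 = \<pi> z" by blast
  then have "\<pi> (q \<odot>\<^bsub>M\<^esub> z) = \<pi> a" using 1[of x] x q AM hom(1) by (simp add: hom(3))
  then have "q \<odot>\<^bsub>M\<^esub> z \<ominus>\<^bsub>M\<^esub> a \<in> Y" using eq q z a AM by simp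
  moreover have "q \<odot>\<^bsub>M\<^esub> z \<ominus>\<^bsub>M\<^esub> a \<in> A"
    using M.submoduleE[OF A] z a q by (simp add: M.M.minus_eq)
  ultimately have "q \<odot>\<^bsub>M\<^esub> z \<ominus>\<^bsub>M\<^esub> a = \<zero>\<^bsub>M\<^esub>" using disj by blast
  then have "q \<odot>\<^bsub>M\<^esub> z = a" using q z a AM by (simp add: M.M.minus_eq_zero_iff)
  then show ?thesis using z by blast
qed

section \<open>Pairs of sequences\<close>

definition fun_module :: "('a, 'b) ring_scheme \<Rightarrow> ('a, 'i \<Rightarrow> 'a) module" where
  "fun_module R = \<lparr>carrier = {x. \<forall>i. x i \<in> carrier R}, monoid.mult = undefined, one = undefined,
     zero = (\<lambda>_. \<zero>\<^bsub>R\<^esub>), add = (\<lambda>x y i. x i \<oplus>\<^bsub>R\<^esub> y i), smult = (\<lambda>r x i. r \<otimes>\<^bsub>R\<^esub> x i)\<rparr>"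

lemma fun_module_simps [simp]:
  "x \<in> carrier (fun_module R) \<longleftrightarrow> (\<forall>i. x i \<in> carrier R)"
  "\<zero>\<^bsub>fun_module R\<^esub> = (\<lambda>_. \<zero>\<^bsub>R\<^esub>)"
  "x \<oplus>\<^bsub>fun_module R\<^esub> y = (\<lambda>i. x i \<oplus>\<^bsub>R\<^esub> y i)"
  "r \<odot>\<^bsub>fun_module R\<^esub> x = (\<lambda>i. r \<otimes>\<^bsub>R\<^esub> x i)"
  by (simp_all add: fun_module_def)

lemma module_fun_module:
  assumes "cring R"
  shows "module R (fun_module R :: ('a, 'i \<Rightarrow> 'a) module)"
proof -
  interpret cring R by fact
  have "abelian_group (fun_module R :: ('a, 'i \<Rightarrow> 'a) module)"
  proof (rule abelian_groupI)
    fix x :: "'i \<Rightarrow> 'a" assume "x \<in> carrier (fun_module R)"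
    then show "\<exists>y\<in>carrier (fun_module R). y \<oplus>\<^bsub>fun_module R\<^esub> x = \<zero>\<^bsub>fun_module R\<^esub>"
      by (intro bexI[of _ "\<lambda>i. \<ominus>\<^bsub>R\<^esub> x i"]) (auto simp: l_neg)
  qed (auto simp: a_ac)
  then show ?thesis
    by (rule moduleI[OF is_cring]) (auto simp: l_distr r_distr m_assoc)
qed

text \<open>
  The case of Krull's intersection theorem for a principal ideal: the successive quotients of a nonzero
  \<open>x\<close> by powers of \<open>f\<close> would generate a strictly increasing chain of ideals.
\<close>

lemma (in noetherian_domain) zero_if_infinitely_divisible:
  fixes k :: nat
  assumes f: "f \<in> carrier R" "f \<notin> Units R" and x: "x \<in> carrier R"
    and dvd: "\<And>n. k \<le> n \<Longrightarrow> \<exists>z\<in>carrier R. x = f [^] n \<otimes> z"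
  shows "x = \<zero>"
proof (rule ccontr)
  assume x0: "x \<noteq> \<zero>"
  have "\<exists>z. \<forall>n. z n \<in> carrier R \<and> x = f [^] (k + n) \<otimes> z n"
    using dvd[OF le_add1] by (intro choice allI) blast
  then obtain z where z: "\<And>n. z n \<in> carrier R" and xz: "\<And>n. x = f [^] (k + n) \<otimes> z n"
    by blast
  have f0: "f \<noteq> \<zero>" "f [^] n \<noteq> \<zero>" for n :: nat
  proof -
    show "f \<noteq> \<zero>" using xz[of 1] z[of 1] f x0 by auto
    then show "f [^] n \<noteq> \<zero>" using f by (induction n) (auto simp: integral_iff)
  qed
  have step: "z n = f \<otimes> z (Suc n)" for n
  proof -
    have "f [^] (k + n) \<otimes> z n = f [^] (k + n) \<otimes> (f \<otimes> z (Suc n))"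
      using xz[of n] xz[of "Suc n"] f z by (simp add: m_assoc)
    then show ?thesis using f0 f z by (simp add: m_lcancel)
  qed
  define C where "C = range (\<lambda>n. PIdl (z n))"
  have "PIdl (z n) \<subseteq> PIdl (z (Suc n))" for n
    using step[of n] f z by (intro to_contain_is_to_divide[THEN iffD2]) (auto simp: m_comm factor_def)
  then have mono: "mono (\<lambda>n. PIdl (z n))" by (rule incseq_SucI)
  have "\<Union>C \<in> C"
  proof (rule ideal_chain_is_trivial)
    show "C \<noteq> {}" by (simp add: C_def)
    show "subset.chain {I. ideal I R} C"
      unfolding subset.chain_def
    proof (intro conjI ballI)
      show "C \<subseteq> {I. ideal I R}" using cgenideal_ideal z by (auto simp: C_def)
      fix I J assume "I \<in> C" "J \<in> C"
      then obtain i j where "I = PIdl (z i)" "J = PIdl (z j)" unfolding C_def by blast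
      then show "(\<subset>)\<^sup>=\<^sup>= I J \<or> (\<subset>)\<^sup>=\<^sup>= J I"
        using monoD[OF mono, of i j] monoD[OF mono, of j i] by (cases "i \<le> j") auto
    qed
  qed
  then obtain n where "\<Union>C = PIdl (z n)" unfolding C_def by blast
  moreover have "z (Suc n) \<in> \<Union>C" unfolding C_def using cgenideal_self z by blast
  ultimately obtain c where c: "c \<in> carrier R" "z (Suc n) = c \<otimes> z n"
    unfolding cgenideal_def by blast
  have zn: "z (Suc n) \<noteq> \<zero>" using xz[of "Suc n"] x0 f z by auto
  have "\<one> \<otimes> z (Suc n) = (f \<otimes> c) \<otimes> z (Suc n)"
    using c z f step[of n] by (metis l_one m_assoc m_comm m_closed)
  then have "f \<otimes> c = \<one>"
    using m_rcancel[OF zn z _ _] c f by (metis m_closed one_closed)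
  then show False using f c m_comm[of c f] unfolding Units_def by auto
qed

text \<open>
  Divisibility of a power of \<open>f\<close> by \<open>g\<close> is excluded to ensure \<open>R[1/f] \<noteq> R[1/h]\<close> for \<open>h = f g\<close>.
\<close>

locale flat_tower = noetherian_domain R for R (structure) +
  fixes f g :: 'a
  assumes f: "f \<in> carrier R" "f \<noteq> \<zero>" "f \<notin> Units R"
    and g: "g \<in> carrier R" "g \<noteq> \<zero>"
    and not_dvd: "r \<in> carrier R \<Longrightarrow> f [^] (m :: nat) \<noteq> r \<otimes> g"
begin

definition h where "h = f \<otimes> g"

lemma h [simp]: "h \<in> carrier R" "h \<noteq> \<zero>"
  using f g by (auto simp: h_def integral_iff)

declare f(1,2) [simp] g [simp]

lemma pow_nonzero [simp]: "a \<in> carrier R \<Longrightarrow> a \<noteq> \<zero> \<Longrightarrow> a [^] (n::nat) \<noteq> \<zero>"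
  by (induction n) (auto simp: integral_iff)

text \<open>
  An element \<open>x\<close> encodes a pair \<open>(s, t)\<close> of sequences in \<open>R\<close>, with \<open>s k = x (Inl k)\<close> and \<open>t k = x (Inr k)\<close>.
  That \<open>t\<close> is eventually geometric with ratio \<open>h\<close> means \<open>t k = v h^k\<close> for large \<open>k\<close> with some \<open>v\<close> in \<open>R[1/h]\<close>.
  The last condition says \<open>s k - t k = u h^k\<close> for large \<open>k\<close>, where \<open>u = r / f^m\<close> lies in \<open>R[1/f]\<close>. Thus
  \<open>v\<close> and \<open>u\<close> are elements of the localisations represented by sequences over \<open>R\<close>.
\<close>

definition pair_seqs :: "(nat + nat \<Rightarrow> 'a) set" where
  "pair_seqs = {x. (\<forall>i. x i \<in> carrier R) \<and>
     (\<forall>\<^sub>F k in sequentially. x (Inr (Suc k)) = h \<otimes> x (Inr k)) \<and>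
     (\<exists>m::nat. \<exists>r\<in>carrier R.
        \<forall>\<^sub>F k in sequentially. f [^] m \<otimes> (x (Inl k) \<ominus> x (Inr k)) = r \<otimes> h [^] k)}"

definition P :: "('a, nat + nat \<Rightarrow> 'a) module" where
  "P = (fun_module R)\<lparr>carrier := pair_seqs\<rparr>"

lemma P_simps [simp]:
  "carrier P = pair_seqs" "\<zero>\<^bsub>P\<^esub> = (\<lambda>_. \<zero>)"
  "x \<oplus>\<^bsub>P\<^esub> y = (\<lambda>i. x i \<oplus> y i)" "r \<odot>\<^bsub>P\<^esub> x = (\<lambda>i. r \<otimes> x i)"
  by (simp_all add: P_def fun_module_def)

lemma pair_seqs_closed: "x \<in> pair_seqs \<Longrightarrow> x i \<in> carrier R"
  by (simp add: pair_seqs_def)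

lemma pair_seqsI:
  assumes "\<And>i. x i \<in> carrier R" "\<forall>\<^sub>F k in sequentially. x (Inr (Suc k)) = h \<otimes> x (Inr k)"
    "r \<in> carrier R" "\<forall>\<^sub>F k in sequentially. f [^] (m::nat) \<otimes> (x (Inl k) \<ominus> x (Inr k)) = r \<otimes> h [^] k"
  shows "x \<in> pair_seqs"
  using assms by (auto simp: pair_seqs_def)

lemma pair_seqs_add:
  assumes x: "x \<in> pair_seqs" and y: "y \<in> pair_seqs"
  shows "(\<lambda>i. x i \<oplus> y i) \<in> pair_seqs"
proof -
  note c = pair_seqs_closed[OF x] pair_seqs_closed[OF y]
  from x obtain m r where x': "\<forall>\<^sub>F k in sequentially. x (Inr (Suc k)) = h \<otimes> x (Inr k)"
    "r \<in> carrier R"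
    "\<forall>\<^sub>F k in sequentially. f [^] (m::nat) \<otimes> (x (Inl k) \<ominus> x (Inr k)) = r \<otimes> h [^] k"
    by (auto simp: pair_seqs_def)
  from y obtain m' r' where y': "\<forall>\<^sub>F k in sequentially. y (Inr (Suc k)) = h \<otimes> y (Inr k)"
    "r' \<in> carrier R"
    "\<forall>\<^sub>F k in sequentially. f [^] (m'::nat) \<otimes> (y (Inl k) \<ominus> y (Inr k)) = r' \<otimes> h [^] k"
    by (auto simp: pair_seqs_def)
  show ?thesis
  proof (rule pair_seqsI)
    show "\<forall>\<^sub>F k in sequentially. x (Inr (Suc k)) \<oplus> y (Inr (Suc k)) = h \<otimes> (x (Inr k) \<oplus> y (Inr k))"
      using x'(1) y'(1) by eventually_elim (simp add: c r_distr)
    show "f [^] m' \<otimes> r \<oplus> f [^] m \<otimes> r' \<in> carrier R" using x' y' by simp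
    show "\<forall>\<^sub>F k in sequentially. f [^] (m + m') \<otimes> (x (Inl k) \<oplus> y (Inl k) \<ominus> (x (Inr k) \<oplus> y (Inr k)))
       = (f [^] m' \<otimes> r \<oplus> f [^] m \<otimes> r') \<otimes> h [^] k"
      using x'(3) y'(3)
    proof eventually_elim
      case (elim k)
      have "f [^] m' \<otimes> (f [^] m \<otimes> (x (Inl k) \<ominus> x (Inr k))) = f [^] m' \<otimes> (r \<otimes> h [^] k)"
        using elim by simp
      moreover have "f [^] m \<otimes> (f [^] m' \<otimes> (y (Inl k) \<ominus> y (Inr k))) = f [^] m \<otimes> (r' \<otimes> h [^] k)"
        using elim by simp
      ultimately show ?case
        using c x'(2) y'(2) f(1) h(1) nat_pow_mult[OF f(1), of m m', symmetric] nat_pow_closed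
        by algebra
    qed
  qed (use c in simp)
qed

lemma pair_seqs_smult:
  assumes a: "a \<in> carrier R" and x: "x \<in> pair_seqs"
  shows "(\<lambda>i. a \<otimes> x i) \<in> pair_seqs"
proof -
  note c = pair_seqs_closed[OF x]
  from x obtain m r where x': "\<forall>\<^sub>F k in sequentially. x (Inr (Suc k)) = h \<otimes> x (Inr k)"
    "r \<in> carrier R"
    "\<forall>\<^sub>F k in sequentially. f [^] (m::nat) \<otimes> (x (Inl k) \<ominus> x (Inr k)) = r \<otimes> h [^] k"
    by (auto simp: pair_seqs_def)
  show ?thesis
  proof (rule pair_seqsI)
    show "\<forall>\<^sub>F k in sequentially. a \<otimes> x (Inr (Suc k)) = h \<otimes> (a \<otimes> x (Inr k))"
      using x'(1) by eventually_elim (simp add: a c m_lcomm)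
    show "a \<otimes> r \<in> carrier R" using a x' by simp
    show "\<forall>\<^sub>F k in sequentially. f [^] m \<otimes> (a \<otimes> x (Inl k) \<ominus> a \<otimes> x (Inr k)) = a \<otimes> r \<otimes> h [^] k"
      using x'(3)
    proof eventually_elim
      case (elim k)
      then have "a \<otimes> (f [^] m \<otimes> (x (Inl k) \<ominus> x (Inr k))) = a \<otimes> (r \<otimes> h [^] k)" by simp
      then show ?case using c x'(2) a f(1) h(1) nat_pow_closed by algebra
    qed
  qed (use c a in simp)
qed

lemma pair_seqs_zero: "(\<lambda>_. \<zero>) \<in> pair_seqs"
  by (rule pair_seqsI[of _ \<zero> 0]) (simp_all add: minus_eq)

lemma module_P: "module R P"
proof -
  interpret F: module R "fun_module R :: ('a, nat + nat \<Rightarrow> 'a) module"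
    by (rule module_fun_module) (rule is_cring)
  have "submodule pair_seqs R (fun_module R)"
    by (rule F.submodule_if_closed)
      (auto simp: pair_seqs_zero pair_seqs_add pair_seqs_smult pair_seqs_closed)
  then show ?thesis unfolding P_def
    by (rule submodule.submodule_is_module) (rule F.module_axioms)
qed

sublocale P: module R P by (rule module_P)

text \<open>
  Modulo \<open>ker_P\<close> only the germ \<open>v\<close> of \<open>t\<close> remains. The sets \<open>B_P\<close>, \<open>A_P\<close> and \<open>X_P\<close> are given by \<open>v = 0\<close>, by
  \<open>v = 0\<close> and \<open>u = 0\<close>, and by \<open>s = 0\<close>; the last one forces \<open>v = - u\<close>, so its image is a copy of \<open>R[1/f]\<close>.
\<close>

definition "ker_P = {x \<in> pair_seqs. (\<forall>k. x (Inl k) = \<zero>) \<and> (\<forall>\<^sub>F k in sequentially. x (Inr k) = \<zero>)}"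
definition "B_P = {x \<in> pair_seqs. \<forall>\<^sub>F k in sequentially. x (Inr k) = \<zero>}"
definition "A_P = {x \<in> B_P. \<forall>\<^sub>F k in sequentially. x (Inl k) = \<zero>}"
definition "X_P = {x \<in> pair_seqs. \<forall>k. x (Inl k) = \<zero>}"

lemma submodule_B: "submodule B_P R P"
proof (rule P.submodule_if_closed)
  fix a b assume ab: "a \<in> B_P" "b \<in> B_P"
  then have "\<forall>\<^sub>F k in sequentially. a (Inr k) \<oplus> b (Inr k) = \<zero>"
    unfolding B_P_def by (auto elim: eventually_elim2)
  then show "a \<oplus>\<^bsub>P\<^esub> b \<in> B_P" using ab by (simp add: B_P_def pair_seqs_add)
next
  fix r a assume "r \<in> carrier R" "a \<in> B_P"
  then show "r \<odot>\<^bsub>P\<^esub> a \<in> B_P"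
    by (auto simp: B_P_def pair_seqs_smult elim: eventually_mono)
qed (auto simp: B_P_def pair_seqs_zero)

lemma submodule_A: "submodule A_P R P"
proof (rule P.submodule_if_closed)
  fix a b assume ab: "a \<in> A_P" "b \<in> A_P"
  then have "\<forall>\<^sub>F k in sequentially. a (Inl k) \<oplus> b (Inl k) = \<zero>"
    unfolding A_P_def by (auto elim: eventually_elim2)
  then show "a \<oplus>\<^bsub>P\<^esub> b \<in> A_P"
    using ab P.submoduleE(5)[OF submodule_B, of a b] by (simp add: A_P_def)
next
  fix r a assume "r \<in> carrier R" "a \<in> A_P"
  then show "r \<odot>\<^bsub>P\<^esub> a \<in> A_P"
    using P.submoduleE(4)[OF submodule_B, of r a]
    by (auto simp: A_P_def elim: eventually_mono)
qed (auto simp: A_P_def B_P_def pair_seqs_zero)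

lemma submodule_X: "submodule X_P R P"
  by (rule P.submodule_if_closed) (auto simp: X_P_def pair_seqs_zero pair_seqs_add pair_seqs_smult)

lemma B_PI:
  assumes "\<And>i. x i \<in> carrier R" "\<forall>\<^sub>F k in sequentially. x (Inr k) = \<zero>"
    "r \<in> carrier R" "\<forall>\<^sub>F k in sequentially. f [^] (m::nat) \<otimes> x (Inl k) = r \<otimes> h [^] k"
  shows "x \<in> B_P"
proof -
  have "\<forall>\<^sub>F k in sequentially. x (Inr (Suc k)) = \<zero>"
    using assms(2) by (subst eventually_sequentially_Suc)
  with assms(2) have "\<forall>\<^sub>F k in sequentially. x (Inr (Suc k)) = h \<otimes> x (Inr k)"
    by eventually_elim simp
  moreover have "\<forall>\<^sub>F k in sequentially. f [^] m \<otimes> (x (Inl k) \<ominus> x (Inr k)) = r \<otimes> h [^] k"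
    using assms(2,4) by eventually_elim (simp add: assms(1) minus_eq)
  ultimately show ?thesis using assms by (auto simp: B_P_def intro: pair_seqsI)
qed

lemma B_PE:
  assumes "x \<in> B_P"
  obtains m :: nat and r where "r \<in> carrier R"
    "\<forall>\<^sub>F k in sequentially. f [^] m \<otimes> x (Inl k) = r \<otimes> h [^] k"
proof -
  from assms obtain m r where r: "r \<in> carrier R" and
    *: "\<forall>\<^sub>F k in sequentially. f [^] (m::nat) \<otimes> (x (Inl k) \<ominus> x (Inr k)) = r \<otimes> h [^] k"
      "\<forall>\<^sub>F k in sequentially. x (Inr k) = \<zero>"
    and c: "\<And>i. x i \<in> carrier R"
    by (auto simp: B_P_def pair_seqs_def)
  from * have "\<forall>\<^sub>F k in sequentially. f [^] m \<otimes> x (Inl k) = r \<otimes> h [^] k"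
    by eventually_elim (simp add: c minus_eq)
  with r show thesis by (rule that)
qed

lemma A_PI:
  assumes "\<And>i. x i \<in> carrier R" "\<forall>\<^sub>F k in sequentially. x (Inr k) = \<zero>"
    "\<forall>\<^sub>F k in sequentially. x (Inl k) = \<zero>"
  shows "x \<in> A_P"
proof -
  have "\<forall>\<^sub>F k in sequentially. f [^] (0::nat) \<otimes> x (Inl k) = \<zero> \<otimes> h [^] k"
    using assms(3) by eventually_elim simp
  then have "x \<in> B_P" using assms by (intro B_PI[of x \<zero> 0]) auto
  then show ?thesis using assms by (simp add: A_P_def)
qed

end

section \<open>Purity in the tower\<close>

lemma sum_fun_eqI:
  assumes "\<And>k. x (Inl k) = y (Inl k)" "\<And>k. x (Inr k) = y (Inr k)"
  shows "x = y"
proof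
  fix i show "x i = y i" using assms by (cases i) auto
qed

text \<open>
  The module \<open>C\<close> is a copy of \<open>P\<close> modulo \<open>ker_P\<close> in an arbitrary type, where \<open>\<phi>\<close> is the projection.
\<close>

locale flat_tower_model = flat_tower +
  fixes C :: "('a, 'm) module" and \<phi> :: "(nat + nat \<Rightarrow> 'a) \<Rightarrow> 'm"
  assumes module_C: "module R C" and \<phi>: "\<phi> \<in> linear_maps R P C"
    and surj: "\<phi> ` pair_seqs = carrier C"
    and ker: "x \<in> pair_seqs \<Longrightarrow> \<phi> x = \<zero>\<^bsub>C\<^esub> \<longleftrightarrow> x \<in> ker_P"
begin

sublocale C: module R C by (rule module_C)

lemmas \<phi>_hom = linear_mapsD[OF \<phi>, simplified]

lemma \<phi>_eq_iff:
  assumes x: "x \<in> pair_seqs" and y: "y \<in> pair_seqs"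
  shows "\<phi> x = \<phi> y \<longleftrightarrow>
    (\<forall>k. x (Inl k) = y (Inl k)) \<and> (\<forall>\<^sub>F k in sequentially. x (Inr k) = y (Inr k))"
proof -
  note c = pair_seqs_closed[OF x] pair_seqs_closed[OF y]
  define d where "d = (\<lambda>i. x i \<oplus> \<ominus> \<one> \<otimes> y i)"
  have eq: "d i = \<zero> \<longleftrightarrow> x i = y i" for i
    using minus_eq_zero_iff[of "x i" "y i"] c by (simp add: d_def minus_eq l_minus)
  have d: "d \<in> pair_seqs" unfolding d_def
    using x y by (intro pair_seqs_add pair_seqs_smult) auto
  have "\<phi> d = \<phi> x \<ominus>\<^bsub>C\<^esub> \<phi> y"
    unfolding d_def using x y pair_seqs_smult[of "\<ominus> \<one>" y] \<phi>_hom(1)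
    by (simp add: \<phi>_hom C.smult_l_minus C.M.minus_eq)
  then have "\<phi> x = \<phi> y \<longleftrightarrow> \<phi> d = \<zero>\<^bsub>C\<^esub>"
    using x y \<phi>_hom(1) by (simp add: C.M.minus_eq_zero_iff)
  then show ?thesis using ker[OF d] d by (simp add: ker_P_def eq)
qed

abbreviation "A \<equiv> \<phi> ` A_P"
abbreviation "B \<equiv> \<phi> ` B_P"
abbreviation "X \<equiv> \<phi> ` X_P"

lemma sub_pair_seqs: "B_P \<subseteq> pair_seqs" "A_P \<subseteq> B_P" "X_P \<subseteq> pair_seqs"
  by (auto simp: A_P_def B_P_def X_P_def)

lemma submodule_images: "submodule A R C" "submodule B R C" "submodule X R C"
  using sublinear_maps_image[OF module_P module_C \<phi>] submodule_A submodule_B submodule_X by auto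

text \<open>
  Cutting \<open>s\<close> off at \<open>N\<close> is the local retraction onto \<open>A\<close>. It ignores \<open>t\<close>, hence kills \<open>X_P\<close> and even shows
  that \<open>A\<close> stays pure modulo \<open>X\<close>.
\<close>

definition trunc :: "nat \<Rightarrow> (nat + nat \<Rightarrow> 'a) \<Rightarrow> nat + nat \<Rightarrow> 'a" where
  "trunc N x = (\<lambda>Inl k \<Rightarrow> if k < N then x (Inl k) else \<zero> | Inr k \<Rightarrow> \<zero>)"

lemma trunc_simps [simp]:
  "trunc N x (Inl k) = (if k < N then x (Inl k) else \<zero>)" "trunc N x (Inr k) = \<zero>"
  by (simp_all add: trunc_def)

lemma trunc_in_A: "x \<in> pair_seqs \<Longrightarrow> trunc N x \<in> A_P"
proof (rule A_PI)
  fix i show "x \<in> pair_seqs \<Longrightarrow> trunc N x i \<in> carrier R"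
    using pair_seqs_closed by (cases i) auto
  show "\<forall>\<^sub>F k in sequentially. trunc N x (Inl k) = \<zero>"
    using eventually_ge_at_top[of N] by eventually_elim simp
qed simp

lemma trunc_add: "x \<in> pair_seqs \<Longrightarrow> y \<in> pair_seqs \<Longrightarrow> trunc N (\<lambda>i. x i \<oplus> y i) = (\<lambda>i. trunc N x i \<oplus> trunc N y i)"
  by (rule sum_fun_eqI) (auto simp: pair_seqs_closed)

lemma trunc_smult: "r \<in> carrier R \<Longrightarrow> x \<in> pair_seqs \<Longrightarrow> trunc N (\<lambda>i. r \<otimes> x i) = (\<lambda>i. r \<otimes> trunc N x i)"
  by (rule sum_fun_eqI) (auto simp: pair_seqs_closed)

lemma trunc_fixes_A:
  assumes "finite E" "E \<subseteq> A_P"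
  shows "\<exists>N. \<forall>a\<in>E. \<phi> (trunc N a) = \<phi> a"
proof -
  have "\<forall>\<^sub>F k in sequentially. \<forall>a\<in>E. a (Inl k) = \<zero>"
    using assms by (intro eventually_ball_finite) (auto simp: A_P_def)
  then obtain N where N: "\<And>k a. k \<ge> N \<Longrightarrow> a \<in> E \<Longrightarrow> a (Inl k) = \<zero>"
    by (auto simp: eventually_sequentially)
  have "\<phi> (trunc N a) = \<phi> a" if a: "a \<in> E" for a
  proof -
    have ab: "a \<in> B_P" "a \<in> pair_seqs" using a assms sub_pair_seqs by auto
    have "trunc N a \<in> pair_seqs" using trunc_in_A[OF ab(2)] sub_pair_seqs by auto
    moreover have "\<forall>\<^sub>F k in sequentially. a (Inr k) = \<zero>" using ab by (simp add: B_P_def)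
    then have "\<forall>\<^sub>F k in sequentially. trunc N a (Inr k) = a (Inr k)" by eventually_elim simp
    ultimately show ?thesis using N[OF _ a] ab by (auto simp: \<phi>_eq_iff)
  qed
  then show ?thesis by blast
qed

lemma pure_A_B: "pure_submodule R (C\<lparr>carrier := B\<rparr>) A"
proof (rule pure_submodule_if_locally_retract[where M = "P\<lparr>carrier := B_P\<rparr>"])
  show MB: "module R (P\<lparr>carrier := B_P\<rparr>)"
    using submodule.submodule_is_module[OF submodule_B module_P] .
  show CB: "module R (C\<lparr>carrier := B\<rparr>)"
    using submodule.submodule_is_module[OF submodule_images(2) module_C] .
  show "\<phi> \<in> linear_maps R (P\<lparr>carrier := B_P\<rparr>) (C\<lparr>carrier := B\<rparr>)"
    by (rule linear_mapsI) (use sub_pair_seqs in \<open>auto simp: \<phi>_hom subset_iff\<close>)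
  show "submodule A_P R (P\<lparr>carrier := B_P\<rparr>)"
    using submodule_restrict[OF module_P submodule_A submodule_B] sub_pair_seqs by simp
  show "submodule A R (C\<lparr>carrier := B\<rparr>)"
    using submodule_restrict[OF module_C submodule_images(1,2)] sub_pair_seqs by blast
next
  fix W E :: "(nat + nat \<Rightarrow> 'a) set"
  assume W: "W \<subseteq> {w \<in> carrier (P\<lparr>carrier := B_P\<rparr>). \<phi> w = \<zero>\<^bsub>C\<lparr>carrier := B\<rparr>\<^esub>}"
    and E: "finite E" "E \<subseteq> A_P"
  obtain N where N: "\<And>a. a \<in> E \<Longrightarrow> \<phi> (trunc N a) = \<phi> a" using trunc_fixes_A[OF E] by blast
  have B: "x \<in> pair_seqs" if "x \<in> B_P" for x using that sub_pair_seqs by auto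
  have "trunc N \<in> linear_maps R (P\<lparr>carrier := B_P\<rparr>) (P\<lparr>carrier := B_P\<rparr>)"
    using trunc_in_A sub_pair_seqs B
    by (intro linear_mapsI) (auto simp: trunc_add trunc_smult)
  moreover have "\<phi> (trunc N w) = \<zero>\<^bsub>C\<^esub>" if "w \<in> W" for w
  proof -
    have w: "w \<in> pair_seqs" "w \<in> ker_P" using W that B ker by auto
    then have "trunc N w = \<zero>\<^bsub>P\<^esub>"
      by (intro sum_fun_eqI) (auto simp: ker_P_def)
    then show ?thesis using linear_maps_zero[OF module_P module_C \<phi>] by simp
  qed
  ultimately show "\<exists>\<tau>\<in>linear_maps R (P\<lparr>carrier := B_P\<rparr>) (P\<lparr>carrier := B_P\<rparr>).
     \<tau> ` carrier (P\<lparr>carrier := B_P\<rparr>) \<subseteq> A_P \<and>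
     (\<forall>w\<in>W. \<phi> (\<tau> w) = \<zero>\<^bsub>C\<lparr>carrier := B\<rparr>\<^esub>) \<and> (\<forall>a\<in>E. \<phi> (\<tau> a) = \<phi> a)"
    using N trunc_in_A B by (intro bexI[of _ "trunc N"]) auto
qed simp

lemma pure_A_quot_X: "pure_submodule R (quot_module C X) (quot_image C X (X <+>\<^bsub>C\<^esub> A))"
proof -
  define \<pi> where "\<pi> c = X +>\<^bsub>C\<^esub> c" for c
  note X = module_C submodule_images(3)
  have Q: "module R (quot_module C X)" by (rule module_quot_module[OF X])
  have \<pi>: "\<pi> \<in> linear_maps R C (quot_module C X)" "\<pi> ` carrier C = carrier (quot_module C X)"
    "c \<in> carrier C \<Longrightarrow> \<pi> c = \<zero>\<^bsub>quot_module C X\<^esub> \<longleftrightarrow> c \<in> X" for c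
    unfolding \<pi>_def[abs_def]
    by (fact quot_module_proj[OF X] quot_module_surj[OF X] quot_module_ker[OF X])+
  have \<pi>\<phi>: "(\<lambda>x. \<pi> (\<phi> x)) \<in> linear_maps R P (quot_module C X)"
    by (rule linear_maps_comp[OF \<phi> \<pi>(1)])
  have "pure_submodule R (quot_module C X) ((\<lambda>x. \<pi> (\<phi> x)) ` A_P)"
  proof (rule pure_submodule_if_locally_retract[OF module_P Q \<pi>\<phi> _ submodule_A])
    show "(\<lambda>x. \<pi> (\<phi> x)) ` carrier P = carrier (quot_module C X)"
      using surj \<pi>(2) by (auto simp flip: image_image)
    show "submodule ((\<lambda>x. \<pi> (\<phi> x)) ` A_P) R (quot_module C X)"
      by (rule sublinear_maps_image[OF module_P Q \<pi>\<phi> submodule_A])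
  next
    fix W E :: "(nat + nat \<Rightarrow> 'a) set"
    assume W: "W \<subseteq> {w \<in> carrier P. \<pi> (\<phi> w) = \<zero>\<^bsub>quot_module C X\<^esub>}"
      and E: "finite E" "E \<subseteq> A_P"
    obtain N where N: "\<And>a. a \<in> E \<Longrightarrow> \<phi> (trunc N a) = \<phi> a" using trunc_fixes_A[OF E] by blast
    have "trunc N \<in> linear_maps R P P"
      using trunc_in_A sub_pair_seqs
      by (intro linear_mapsI) (auto simp: trunc_add trunc_smult)
    moreover have "\<pi> (\<phi> (trunc N w)) = \<zero>\<^bsub>quot_module C X\<^esub>" if "w \<in> W" for w
    proof -
      have w: "w \<in> pair_seqs" "\<phi> w \<in> X" using W that \<pi>(3) \<phi>_hom(1) by auto
      then obtain x where x: "x \<in> X_P" "\<phi> w = \<phi> x" by blast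
      then have "w (Inl k) = \<zero>" for k
        using w \<phi>_eq_iff[of w x] sub_pair_seqs(3) by (auto simp: X_P_def)
      then have "trunc N w = \<zero>\<^bsub>P\<^esub>"
        by (intro sum_fun_eqI) auto
      then show ?thesis using linear_maps_zero[OF module_P Q \<pi>\<phi>] by simp
    qed
    ultimately show "\<exists>\<tau>\<in>linear_maps R P P. \<tau> ` carrier P \<subseteq> A_P \<and>
       (\<forall>w\<in>W. \<pi> (\<phi> (\<tau> w)) = \<zero>\<^bsub>quot_module C X\<^esub>) \<and> (\<forall>a\<in>E. \<pi> (\<phi> (\<tau> a)) = \<pi> (\<phi> a))"
      using N trunc_in_A by (intro bexI[of _ "trunc N"]) auto
  qed
  then show ?thesis
    using quot_image_sum[OF X submodule_images(1)] by (simp add: image_image \<pi>_def)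
qed

text \<open>
  On elements whose \<open>t\<close> is geometric from \<open>N\<close> on, subtracting the tail of \<open>t\<close> from \<open>s\<close> is a retraction onto
  \<open>B\<close>. It reflects that \<open>C/B = R[1/h]\<close> is the union of the free modules \<open>h^-N R\<close>, over which the
  extension splits; purity of \<open>B\<close> is the flatness of \<open>R[1/h]\<close>.
\<close>

definition split_off :: "nat \<Rightarrow> (nat + nat \<Rightarrow> 'a) \<Rightarrow> nat + nat \<Rightarrow> 'a" where
  "split_off N x = (\<lambda>Inl k \<Rightarrow> x (Inl k) \<ominus> (if N \<le> k then x (Inr k) else \<zero>) | Inr k \<Rightarrow> \<zero>)"

lemma split_off_simps [simp]:
  "split_off N x (Inl k) = x (Inl k) \<ominus> (if N \<le> k then x (Inr k) else \<zero>)"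
  "split_off N x (Inr k) = \<zero>"
  by (simp_all add: split_off_def)

lemma split_off_in_B:
  assumes x: "x \<in> pair_seqs"
  shows "split_off N x \<in> B_P"
proof -
  note c = pair_seqs_closed[OF x]
  from x obtain m r where r: "r \<in> carrier R" and
    "\<forall>\<^sub>F k in sequentially. f [^] (m::nat) \<otimes> (x (Inl k) \<ominus> x (Inr k)) = r \<otimes> h [^] k"
    by (auto simp: pair_seqs_def)
  from this(2) have ev: "\<forall>\<^sub>F k in sequentially. f [^] m \<otimes> split_off N x (Inl k) = r \<otimes> h [^] k"
    using eventually_ge_at_top[of N] by eventually_elim simp
  show ?thesis
  proof (rule B_PI[OF _ _ r ev])
    show "split_off N x i \<in> carrier R" for i using c by (cases i) auto
  qed simp
qed

lemma split_off_hom: "split_off N \<in> linear_maps R P P"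
proof (rule linear_mapsI)
  fix x y assume "x \<in> carrier P" "y \<in> carrier P"
  then have c: "x i \<in> carrier R" "y i \<in> carrier R" for i by (simp_all add: pair_seqs_closed)
  have "x i \<oplus> y i \<ominus> (x j \<oplus> y j) = (x i \<ominus> x j) \<oplus> (y i \<ominus> y j)" for i j
    using c[of i] c[of j] by algebra
  then show "split_off N (x \<oplus>\<^bsub>P\<^esub> y) = split_off N x \<oplus>\<^bsub>P\<^esub> split_off N y"
    by (intro sum_fun_eqI) (auto simp: c minus_eq)
next
  fix r x assume r: "r \<in> carrier R" and "x \<in> carrier P"
  then have c: "x i \<in> carrier R" for i by (simp_all add: pair_seqs_closed)
  have "r \<otimes> x i \<ominus> r \<otimes> x j = r \<otimes> (x i \<ominus> x j)" for i j
    using c[of i] c[of j] r by algebra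
  then show "split_off N (r \<odot>\<^bsub>P\<^esub> x) = r \<odot>\<^bsub>P\<^esub> split_off N x"
    by (intro sum_fun_eqI) (auto simp: c r minus_eq)
qed (use split_off_in_B sub_pair_seqs in auto)

lemma pure_B_C: "pure_submodule R C B"
proof (rule pure_submodule_if_locally_retract[OF module_P module_C \<phi> _ submodule_B submodule_images(2)])
  show "\<phi> ` carrier P = carrier C" using surj by simp
next
  fix W E :: "(nat + nat \<Rightarrow> 'a) set"
  assume W: "finite W" "W \<subseteq> {w \<in> carrier P. \<phi> w = \<zero>\<^bsub>C\<^esub>}" and E: "finite E" "E \<subseteq> B_P"
  have "\<forall>\<^sub>F k in sequentially. \<forall>x\<in>W \<union> E. x (Inr k) = \<zero>"
    using W E ker by (intro eventually_ball_finite) (auto simp: B_P_def ker_P_def)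
  then obtain N where N: "\<And>k x. k \<ge> N \<Longrightarrow> x \<in> W \<union> E \<Longrightarrow> x (Inr k) = \<zero>"
    by (auto simp: eventually_sequentially)
  have c: "x i \<in> carrier R" if "x \<in> W \<union> E" for x i
    using that W E pair_seqs_closed sub_pair_seqs by auto
  have "\<phi> (split_off N x) = \<phi> x" if x: "x \<in> W \<union> E" for x
  proof -
    have xB: "x \<in> pair_seqs" using W E sub_pair_seqs x by auto
    have "split_off N x \<in> pair_seqs" using split_off_in_B[OF xB] sub_pair_seqs by auto
    moreover have "\<forall>\<^sub>F k in sequentially. split_off N x (Inr k) = x (Inr k)"
      using eventually_ge_at_top[of N] by eventually_elim (simp add: N[OF _ x])
    ultimately show ?thesis using N[OF _ x] xB c[OF x] by (auto simp: \<phi>_eq_iff minus_eq)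
  qed
  then show "\<exists>\<tau>\<in>linear_maps R P P. \<tau> ` carrier P \<subseteq> B_P \<and>
       (\<forall>w\<in>W. \<phi> (\<tau> w) = \<zero>\<^bsub>C\<^esub>) \<and> (\<forall>a\<in>E. \<phi> (\<tau> a) = \<phi> a)"
    using W split_off_in_B by (intro bexI[OF _ split_off_hom[of N]]) auto
qed

end

section \<open>Essentiality in the tower\<close>

context flat_tower_model
begin

text \<open>
  Let \<open>Y\<close> meet \<open>A\<close> in \<open>0\<close> with \<open>A\<close> pure modulo \<open>Y\<close>, and let \<open>y\<close> in \<open>Y\<close> have the first component \<open>s\<close>, where
  \<open>f^m s k = r h^k\<close> for large \<open>k\<close>. The element \<open>b\<close> below has \<open>u = 1/f^n\<close>, so \<open>r f^n b\<close> agrees with \<open>f^m y\<close>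
  up to an element of \<open>A\<close>, which therefore is divisible by \<open>r f^n\<close> within \<open>A\<close>. As \<open>b\<close> vanishes
  before \<open>n\<close>, this makes \<open>f^m s k\<close> divisible by \<open>f^n\<close> for every \<open>n > k\<close>, hence zero.
\<close>

lemma pure_essential_A_B: "pure_essential R (C\<lparr>carrier := B\<rparr>) A"
  unfolding pure_essential_def
proof (intro conjI allI impI pure_A_B)
  let ?B = "C\<lparr>carrier := B\<rparr>"
  have CB: "module R ?B"
    using submodule.submodule_is_module[OF submodule_images(2) module_C] .
  interpret CB: module R ?B by fact
  have AB: "submodule A R ?B"
    using submodule_restrict[OF module_C submodule_images(1,2)] sub_pair_seqs by blast
  fix Y assume Y: "submodule Y R ?B" "Y \<inter> A = {\<zero>\<^bsub>?B\<^esub>}"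
    and pure: "pure_submodule R (quot_module ?B Y) (quot_image ?B Y (Y <+>\<^bsub>?B\<^esub> A))"
  have zero: "y = \<zero>\<^bsub>C\<^esub>" if y: "y \<in> Y" for y
  proof -
    have "y \<in> B" using CB.submoduleE(1)[OF Y(1)] y by auto
    then obtain x where x: "x \<in> B_P" "y = \<phi> x" by blast
    then have xP: "x \<in> pair_seqs" and c [simp]: "x i \<in> carrier R" for i
      using sub_pair_seqs pair_seqs_closed by auto
    obtain m r where r [simp]: "r \<in> carrier R"
      and mr: "\<forall>\<^sub>F k in sequentially. f [^] (m::nat) \<otimes> x (Inl k) = r \<otimes> h [^] k"
      using x(1) by (rule B_PE)
    have xr: "\<forall>\<^sub>F k in sequentially. x (Inr k) = \<zero>" using x(1) by (simp add: B_P_def)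
    have dvd: "\<exists>z\<in>carrier R. f [^] m \<otimes> x (Inl k) = f [^] n \<otimes> z" if kn: "Suc k \<le> n" for k n :: nat
    proof -
      \<comment> \<open>For \<open>n \<le> k\<close> the first component is \<open>h^k / f^n\<close>, written without division.\<close>
      define b :: "nat + nat \<Rightarrow> 'a" where "b = (\<lambda>Inl k \<Rightarrow> if n \<le> k then g [^] n \<otimes> h [^] (k - n) else \<zero> | Inr k \<Rightarrow> \<zero>)"
      define a where "a = (\<lambda>i. (r \<otimes> f [^] n) \<otimes> b i \<oplus> (\<ominus> (f [^] m)) \<otimes> x i)"
      have bc [simp]: "b i \<in> carrier R" for i by (cases i) (auto simp: b_def)
      have fb: "f [^] n \<otimes> b (Inl k) = h [^] k" if "n \<le> k" for k
      proof -
        have "f [^] n \<otimes> b (Inl k) = h [^] n \<otimes> h [^] (k - n)"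
          using that by (simp add: b_def h_def nat_pow_distrib m_assoc m_comm)
        then show ?thesis using that by (simp add: nat_pow_mult)
      qed
      have bB: "b \<in> B_P"
      proof (rule B_PI[of b \<one> n])
        show "\<forall>\<^sub>F k in sequentially. f [^] n \<otimes> b (Inl k) = \<one> \<otimes> h [^] k"
          using eventually_ge_at_top[of n] by eventually_elim (simp add: fb)
        show "b i \<in> carrier R" for i by (rule bc)
      qed (auto simp: b_def)
      have aA: "a \<in> A_P"
      proof (rule A_PI)
        show "\<forall>\<^sub>F k in sequentially. a (Inr k) = \<zero>"
          using xr by eventually_elim (simp add: a_def b_def)
        show "\<forall>\<^sub>F k in sequentially. a (Inl k) = \<zero>"
          using mr eventually_ge_at_top[of n]
        proof eventually_elim
          case (elim k)
          then show ?case by (simp add: a_def m_assoc fb l_minus r_neg)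
        qed
      qed (simp add: a_def)
      have "(\<lambda>i. (r \<otimes> f [^] n) \<otimes> b i) = (\<lambda>i. f [^] m \<otimes> x i \<oplus> a i)"
      proof
        fix i
        have "f [^] m \<in> carrier R" "f [^] n \<in> carrier R" by simp_all
        then show "(r \<otimes> f [^] n) \<otimes> b i = f [^] m \<otimes> x i \<oplus> a i"
          unfolding a_def using c[of i] bc[of i] r by algebra
      qed
      then have "\<phi> (\<lambda>i. (r \<otimes> f [^] n) \<otimes> b i) = \<phi> (\<lambda>i. f [^] m \<otimes> x i \<oplus> a i)" by simp
      then have eq: "(r \<otimes> f [^] n) \<odot>\<^bsub>C\<^esub> \<phi> b = f [^] m \<odot>\<^bsub>C\<^esub> y \<oplus>\<^bsub>C\<^esub> \<phi> a"
        using bB aA sub_pair_seqs xP x(2) by (simp add: \<phi>_hom pair_seqs_smult subset_iff)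
      have yY: "f [^] m \<odot>\<^bsub>C\<^esub> y \<in> Y"
        using CB.submoduleE(4)[OF Y(1), of "f [^] m" y] y by simp
      have "\<exists>z\<in>A. (r \<otimes> f [^] n) \<odot>\<^bsub>?B\<^esub> z = \<phi> a"
        by (rule divide_if_pure_in_quot[OF CB Y(1) AB Y(2) pure, of _ "\<phi> b" _ "f [^] m \<odot>\<^bsub>C\<^esub> y"])
          (use eq yY bB aA in simp_all)
      then obtain z where z: "z \<in> A" "(r \<otimes> f [^] n) \<odot>\<^bsub>C\<^esub> z = \<phi> a" by auto
      then obtain z' where z': "z' \<in> A_P" "z = \<phi> z'" by blast
      then have z'c: "z' \<in> pair_seqs" "z' i \<in> carrier R" for i
        using sub_pair_seqs pair_seqs_closed by auto
      have "\<phi> (\<lambda>i. (r \<otimes> f [^] n) \<otimes> z' i) = \<phi> a"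
        using z z' z'c by (simp add: \<phi>_hom)
      then have "(r \<otimes> f [^] n) \<otimes> z' (Inl k) = a (Inl k)"
        using \<phi>_eq_iff[OF pair_seqs_smult[OF _ z'c(1)], of "r \<otimes> f [^] n" a] aA sub_pair_seqs
        by auto
      then have "(r \<otimes> f [^] n) \<otimes> z' (Inl k) = \<ominus> (f [^] m \<otimes> x (Inl k))"
        using kn by (simp add: a_def b_def l_minus)
      then have "f [^] m \<otimes> x (Inl k) = \<ominus> ((r \<otimes> f [^] n) \<otimes> z' (Inl k))" by simp
      also have "\<dots> = f [^] n \<otimes> (\<ominus> (r \<otimes> z' (Inl k)))"
        using z'c by (simp add: r_minus m_ac)
      finally show ?thesis using z'c by (intro bexI) auto
    qed
    have "x (Inl k) = \<zero>" for k
    proof -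
      have "f [^] m \<otimes> x (Inl k) = \<zero>"
        by (rule zero_if_infinitely_divisible[OF f(1,3) _ dvd]) auto
      then show ?thesis by (simp add: integral_iff)
    qed
    then have "x \<in> ker_P" using xP xr by (simp add: ker_P_def)
    then show ?thesis using x ker xP by simp
  qed
  show "Y = {\<zero>\<^bsub>?B\<^esub>}"
  proof (intro equalityI subsetI)
    fix y assume "y \<in> Y"
    from zero[OF this] show "y \<in> {\<zero>\<^bsub>?B\<^esub>}" by simp
  qed (use CB.submodule_zero[OF Y(1)] in simp)
qed

text \<open>
  The same argument with \<open>h\<close> in place of \<open>f\<close>, applied to the germ \<open>v\<close> of an element \<open>y\<close> of \<open>Y\<close>, yields
  \<open>s = 0\<close>. If \<open>v \<noteq> 0\<close>, the case \<open>n = 1\<close> moreover produces an element of \<open>B\<close> whose \<open>u\<close> is \<open>1/h\<close>, which is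
  not in \<open>R[1/f]\<close>. The submodule \<open>X\<close> shows that \<open>s = 0\<close> alone would not suffice.
\<close>

lemma pure_essential_B_C: "pure_essential R C B"
  unfolding pure_essential_def
proof (intro conjI allI impI pure_B_C)
  fix Y assume Y: "submodule Y R C" "Y \<inter> B = {\<zero>\<^bsub>C\<^esub>}"
    and pure: "pure_submodule R (quot_module C Y) (quot_image C Y (Y <+>\<^bsub>C\<^esub> B))"
  have zero: "y = \<zero>\<^bsub>C\<^esub>" if y: "y \<in> Y" for y
  proof -
    have "y \<in> carrier C" using C.submoduleE(1)[OF Y(1)] y by auto
    then obtain x where xP: "x \<in> pair_seqs" "y = \<phi> x" using surj by blast
    then have c [simp]: "x i \<in> carrier R" for i
      using pair_seqs_closed by auto
    have "\<forall>\<^sub>F k in sequentially. x (Inr (Suc k)) = h \<otimes> x (Inr k)"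
      using xP(1) by (simp add: pair_seqs_def)
    then obtain m where m: "\<And>k. m \<le> k \<Longrightarrow> x (Inr (Suc k)) = h \<otimes> x (Inr k)"
      by (auto simp: eventually_sequentially)
    define r where "r = x (Inr m)"
    have r [simp]: "r \<in> carrier R" by (simp add: r_def)
    have mr: "h [^] m \<otimes> x (Inr k) = r \<otimes> h [^] k" if "m \<le> k" for k
      using that
    proof (induction k rule: dec_induct)
      case base
      then show ?case by (simp add: r_def m_comm)
    next
      case (step k)
      have "h [^] m \<otimes> x (Inr (Suc k)) = h \<otimes> (h [^] m \<otimes> x (Inr k))"
        using step m by (simp add: m_lcomm)
      also have "\<dots> = r \<otimes> h [^] Suc k" using step by (simp add: m_ac)
      finally show ?case .
    qed
    \<comment> \<open>Here \<open>v = 1/h^n\<close> and \<open>u = 0\<close>.\<close>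
    define b :: "nat \<Rightarrow> nat + nat \<Rightarrow> 'a" where "b n = (\<lambda>i. case i of Inl k \<Rightarrow> if n \<le> k then h [^] (k - n) else \<zero>
       | Inr k \<Rightarrow> if n \<le> k then h [^] (k - n) else \<zero>)" for n :: nat
    have bc [simp]: "b n i \<in> carrier R" for n i by (cases i) (auto simp: b_def)
    have hb: "h [^] n \<otimes> b n (Inl k) = h [^] k" "h [^] n \<otimes> b n (Inr k) = h [^] k"
      if "n \<le> k" for n k
      using that by (simp_all add: b_def nat_pow_mult)
    have bP: "b n \<in> pair_seqs" for n
    proof (rule pair_seqsI[of _ \<zero> 0])
      show "\<forall>\<^sub>F k in sequentially. b n (Inr (Suc k)) = h \<otimes> b n (Inr k)"
        using eventually_ge_at_top[of n]
      proof eventually_elim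
        case (elim k)
        then show ?case by (simp add: b_def Suc_diff_le m_comm)
      qed
      show "\<forall>\<^sub>F k in sequentially. f [^] (0::nat) \<otimes> (b n (Inl k) \<ominus> b n (Inr k)) = \<zero> \<otimes> h [^] k"
        by (rule always_eventually) (simp add: b_def minus_eq r_neg)
    qed auto
    have div: "\<exists>z\<in>B_P. \<forall>k. (r \<otimes> h [^] n) \<otimes> z (Inl k)
        = (r \<otimes> h [^] n) \<otimes> b n (Inl k) \<oplus> (\<ominus> (h [^] m)) \<otimes> x (Inl k)" for n
    proof -
      define a where "a = (\<lambda>i. (r \<otimes> h [^] n) \<otimes> b n i \<oplus> (\<ominus> (h [^] m)) \<otimes> x i)"
      have "a \<in> pair_seqs" unfolding a_def
        by (intro pair_seqs_add pair_seqs_smult bP xP(1)) auto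
      moreover have "\<forall>\<^sub>F k in sequentially. a (Inr k) = \<zero>"
        using eventually_ge_at_top[of n] eventually_ge_at_top[of m]
      proof eventually_elim
        case (elim k)
        have "(\<ominus> (h [^] m)) \<otimes> x (Inr k) = \<ominus> (r \<otimes> h [^] k)"
          using mr[OF elim(2)] by (simp add: l_minus)
        then show ?case using elim(1) by (simp add: a_def m_assoc hb r_neg)
      qed
      ultimately have aB: "a \<in> B_P" by (simp add: B_P_def)
      have "(\<lambda>i. (r \<otimes> h [^] n) \<otimes> b n i) = (\<lambda>i. h [^] m \<otimes> x i \<oplus> a i)"
      proof
        fix i
        have "h [^] m \<in> carrier R" "h [^] n \<in> carrier R" by simp_all
        then show "(r \<otimes> h [^] n) \<otimes> b n i = h [^] m \<otimes> x i \<oplus> a i"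
          unfolding a_def using c[of i] bc[of n i] r by algebra
      qed
      then have "\<phi> (\<lambda>i. (r \<otimes> h [^] n) \<otimes> b n i) = \<phi> (\<lambda>i. h [^] m \<otimes> x i \<oplus> a i)" by simp
      then have eq: "(r \<otimes> h [^] n) \<odot>\<^bsub>C\<^esub> \<phi> (b n) = h [^] m \<odot>\<^bsub>C\<^esub> y \<oplus>\<^bsub>C\<^esub> \<phi> a"
        using bP aB sub_pair_seqs xP by (simp add: \<phi>_hom pair_seqs_smult subset_iff)
      have yY: "h [^] m \<odot>\<^bsub>C\<^esub> y \<in> Y"
        using C.submoduleE(4)[OF Y(1), of "h [^] m" y] y by simp
      have "\<exists>z\<in>B. (r \<otimes> h [^] n) \<odot>\<^bsub>C\<^esub> z = \<phi> a"
        by (rule divide_if_pure_in_quot[OF module_C Y(1) submodule_images(2) Y(2) pure _ _ _ yY eq])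
          (use \<phi>_hom(1)[OF bP] aB in simp_all)
      then obtain z where z: "z \<in> B" "(r \<otimes> h [^] n) \<odot>\<^bsub>C\<^esub> z = \<phi> a" by blast
      then obtain z' where z': "z' \<in> B_P" "z = \<phi> z'" by blast
      then have z'c: "z' \<in> pair_seqs" using sub_pair_seqs by auto
      have "\<phi> (\<lambda>i. (r \<otimes> h [^] n) \<otimes> z' i) = \<phi> a"
        using z z' z'c by (simp add: \<phi>_hom)
      then have "\<forall>k. (r \<otimes> h [^] n) \<otimes> z' (Inl k) = a (Inl k)"
        using \<phi>_eq_iff[OF pair_seqs_smult[OF _ z'c(1)], of "r \<otimes> h [^] n" a] aB sub_pair_seqs
        by auto
      then show ?thesis using z' by (auto simp: a_def)
    qed
    have h_nonunit: "h \<notin> Units R"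
      using f(1,3) g(1) unit_factor[of f g] by (auto simp: h_def)
    have xl: "x (Inl k) = \<zero>" for k
    proof -
      have "\<exists>z\<in>carrier R. h [^] m \<otimes> x (Inl k) = h [^] n \<otimes> z" if kn: "k < n" for n
      proof -
        obtain z where z: "z \<in> B_P" and eq: "(r \<otimes> h [^] n) \<otimes> z (Inl k)
           = (r \<otimes> h [^] n) \<otimes> b n (Inl k) \<oplus> (\<ominus> (h [^] m)) \<otimes> x (Inl k)" using div[of n] by blast
        have zc: "z i \<in> carrier R" for i using z sub_pair_seqs pair_seqs_closed by auto
        have "(r \<otimes> h [^] n) \<otimes> z (Inl k) = \<ominus> (h [^] m \<otimes> x (Inl k))"
          using eq kn by (simp add: b_def l_minus)
        then have "h [^] m \<otimes> x (Inl k) = \<ominus> ((r \<otimes> h [^] n) \<otimes> z (Inl k))" by simp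
        also have "\<dots> = h [^] n \<otimes> (\<ominus> (r \<otimes> z (Inl k)))"
          using zc by (simp add: r_minus m_ac)
        finally show ?thesis using zc by (intro bexI) auto
      qed
      then have "h [^] m \<otimes> x (Inl k) = \<zero>"
        by (intro zero_if_infinitely_divisible[OF h(1) h_nonunit, of _ "Suc k"]) auto
      then show ?thesis by (simp add: integral_iff)
    qed
    have "r = \<zero>"
    proof (rule ccontr)
      assume r0: "r \<noteq> \<zero>"
      obtain z where z: "z \<in> B_P" and eq: "\<And>k. (r \<otimes> h [^] Suc 0) \<otimes> z (Inl k)
           = (r \<otimes> h [^] Suc 0) \<otimes> b (Suc 0) (Inl k)" using div[of "Suc 0"] by (auto simp: xl)
      have zc [simp]: "z i \<in> carrier R" for i using z sub_pair_seqs pair_seqs_closed by auto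
      have zb: "z (Inl k) = b (Suc 0) (Inl k)" for k
        using eq[of k] m_lcancel[of "r \<otimes> h [^] Suc 0"] r0 by (simp add: integral_iff)
      obtain l s where s: "s \<in> carrier R"
        and "\<forall>\<^sub>F k in sequentially. f [^] (l::nat) \<otimes> z (Inl k) = s \<otimes> h [^] k"
        using z by (rule B_PE)
      then obtain k where k: "\<And>k'. k \<le> k' \<Longrightarrow> f [^] l \<otimes> z (Inl k') = s \<otimes> h [^] k'"
        by (auto simp: eventually_sequentially)
      have "f [^] l \<otimes> h [^] k = s \<otimes> (h \<otimes> h [^] k)"
        using k[of "Suc k"] by (simp add: zb b_def m_comm)
      then have "f [^] l \<otimes> h [^] k = (s \<otimes> h) \<otimes> h [^] k" using s by (simp add: m_assoc)
      then have "f [^] l = s \<otimes> h" using s by (simp add: m_rcancel)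
      then have "f [^] l = (s \<otimes> f) \<otimes> g" using s by (simp add: h_def m_assoc)
      then show False using not_dvd[of "s \<otimes> f" l] s by simp
    qed
    then have "\<forall>\<^sub>F k in sequentially. x (Inr k) = \<zero>"
      using mr by (auto simp: eventually_sequentially integral_iff)
    then have "x \<in> ker_P" using xP xl by (simp add: ker_P_def)
    then show ?thesis using ker xP by simp
  qed
  show "Y = {\<zero>\<^bsub>C\<^esub>}"
  proof (intro equalityI subsetI)
    fix y assume "y \<in> Y"
    from zero[OF this] show "y \<in> {\<zero>\<^bsub>C\<^esub>}" by simp
  qed (use C.submodule_zero[OF Y(1)] in simp)
qed

text \<open>
  The submodule \<open>X\<close> is the obstruction; it contains the nonzero element with \<open>s = 0\<close>, \<open>v = 1\<close> and \<open>u = -1\<close>.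
\<close>

lemma not_pure_essential_A_C: "\<not> pure_essential R C A"
proof
  assume "pure_essential R C A"
  moreover have "X \<inter> A = {\<zero>\<^bsub>C\<^esub>}"
  proof -
    have zero: "c = \<zero>\<^bsub>C\<^esub>" if c: "c \<in> X" "c \<in> A" for c
    proof -
      obtain x a where x: "x \<in> X_P" "c = \<phi> x" and a: "a \<in> A_P" "c = \<phi> a" using c by blast
      have xa: "x \<in> pair_seqs" "a \<in> pair_seqs" using x a sub_pair_seqs by auto
      have "a (Inl k) = \<zero>" for k
        using \<phi>_eq_iff[OF xa] x a by (auto simp: X_P_def)
      then have "a \<in> ker_P" using a xa by (simp add: ker_P_def A_P_def B_P_def)
      then show ?thesis using ker[OF xa(2)] a by simp
    qed
    show ?thesis
    proof (intro equalityI subsetI)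
      fix c assume "c \<in> X \<inter> A"
      then show "c \<in> {\<zero>\<^bsub>C\<^esub>}" using zero[of c] by blast
    qed (use C.submodule_zero[OF submodule_images(1)] C.submodule_zero[OF submodule_images(3)] in simp)
  qed
  ultimately have X0: "X = {\<zero>\<^bsub>C\<^esub>}"
    using pure_A_quot_X submodule_images(3) by (auto simp: pure_essential_def)
  define x :: "nat + nat \<Rightarrow> 'a" where "x = (\<lambda>Inl k \<Rightarrow> \<zero> | Inr k \<Rightarrow> h [^] k)"
  have x: "x (Inl k) = \<zero>" "x (Inr k) = h [^] k" for k by (simp_all add: x_def)
  have "x \<in> pair_seqs"
  proof (rule pair_seqsI[of _ "\<ominus> \<one>" 0])
    show "x i \<in> carrier R" for i by (cases i) (auto simp: x)
  qed (auto simp: x minus_eq m_comm l_minus)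
  then have "x \<in> X_P" "x \<in> pair_seqs" by (auto simp: X_P_def x)
  then have "x \<in> ker_P" using X0 ker by blast
  then show False by (auto simp: ker_P_def x eventually_sequentially)
qed

end

section \<open>A copy of the tower in a given type\<close>

lemma ex_inj_lists:
  assumes "infinite A"
  shows "\<exists>e. inj_on e (lists A) \<and> e ` lists A \<subseteq> A"
proof -
  from assms obtain c :: "nat \<Rightarrow> 'a" where c: "inj c" "range c \<subseteq> A"
    unfolding infinite_iff_countable_subset by (elim exE conjE)
  obtain p where p: "inj_on p (A \<times> A)" "p ` (A \<times> A) \<subseteq> A"
    using ordIso_imp_ordLeq[OF card_of_Times_same_infinite[OF assms]]
    unfolding card_of_ordLeq[symmetric] by blast
  define enc where "enc = (\<lambda>xs. foldr (\<lambda>x y. p (x, y)) xs (c 0))"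
  have enc: "enc [] = c 0" "enc (x # xs) = p (x, enc xs)" for x xs by (simp_all add: enc_def)
  have encA: "enc xs \<in> A" if "xs \<in> lists A" for xs
    using that by induction (use c p in \<open>auto simp: enc\<close>)
  have enc_inj: "xs = ys" if "length xs = length ys" "xs \<in> lists A" "ys \<in> lists A" "enc xs = enc ys" for xs ys
    using that
  proof (induction rule: list_induct2)
    case (Cons x xs y ys)
    then have "(x, enc xs) = (y, enc ys)"
      using p(1) encA by (intro inj_onD[OF p(1)]) (auto simp: enc)
    then show ?case using Cons by auto
  qed simp
  define e where "e xs = p (c (length xs), enc xs)" for xs
  have cA: "c n \<in> A" for n using c(2) by blast
  have "inj_on e (lists A)"
  proof (rule inj_onI)
    fix xs ys assume xy: "xs \<in> lists A" "ys \<in> lists A" "e xs = e ys"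
    then have "(c (length xs), enc xs) = (c (length ys), enc ys)"
      using encA cA by (intro inj_onD[OF p(1)]) (auto simp: e_def)
    then show "xs = ys" using enc_inj xy c(1) by (auto simp: inj_eq)
  qed
  moreover have "e xs \<in> A" if "xs \<in> lists A" for xs
    unfolding e_def using p(2) cA encA[OF that] by blast
  then have "e ` lists A \<subseteq> A" by blast
  ultimately show ?thesis by blast
qed

context flat_tower
begin

lemma infinite_carrier: "infinite (carrier R)"
proof
  assume "finite (carrier R)"
  moreover have "range (\<lambda>n::nat. f [^] n) \<subseteq> carrier R" by auto
  ultimately have "\<not> inj (\<lambda>n::nat. f [^] n)"
    using finite_imageD finite_subset infinite_UNIV_nat by blast
  then obtain i j :: nat where "f [^] i = f [^] j" "i < j"
    unfolding inj_def by (metis linorder_neqE_nat)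
  moreover have "f [^] i \<otimes> f [^] (j - i) = f [^] j"
    using \<open>i < j\<close> f(1) nat_pow_mult[of f i "j - i"] by simp
  ultimately have "f [^] i \<otimes> \<one> = f [^] i \<otimes> f [^] (j - i)" by simp
  then have "f [^] (j - i) = \<one>"
    using m_lcancel[of "f [^] i" \<one> "f [^] (j - i)"] by simp
  moreover obtain n where "j - i = Suc n" using \<open>i < j\<close> by (metis Suc_diff_Suc)
  ultimately have "f [^] n \<otimes> f = \<one>" by simp
  then have "f \<in> Units R" using m_comm[of "f [^] n" f] unfolding Units_def by auto
  then show False using f(3) by simp
qed

lemma eventually_geometric:
  assumes x: "x \<in> pair_seqs"
  shows "\<forall>\<^sub>F k in sequentially. x (Inl (Suc k)) = h \<otimes> x (Inl k)"
proof -
  note c [simp] = pair_seqs_closed[OF x]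
  from x obtain m r where r: "\<forall>\<^sub>F k in sequentially. x (Inr (Suc k)) = h \<otimes> x (Inr k)"
    "r \<in> carrier R" and
    ev: "\<forall>\<^sub>F k in sequentially. f [^] (m::nat) \<otimes> (x (Inl k) \<ominus> x (Inr k)) = r \<otimes> h [^] k"
    by (auto simp: pair_seqs_def)
  have "\<forall>\<^sub>F k in sequentially. f [^] m \<otimes> (x (Inl (Suc k)) \<ominus> x (Inr (Suc k))) = r \<otimes> h [^] Suc k"
    using ev by (subst eventually_sequentially_Suc)
  with r(1) ev show ?thesis
  proof eventually_elim
    case (elim k)
    have "f [^] m \<otimes> (x (Inl (Suc k)) \<ominus> x (Inr (Suc k))) = h \<otimes> (r \<otimes> h [^] k)"
      using elim(3) r(2) by (simp add: m_ac)
    also have "\<dots> = f [^] m \<otimes> (h \<otimes> (x (Inl k) \<ominus> x (Inr k)))"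
      unfolding elim(2)[symmetric] by (simp add: m_lcomm)
    finally have "x (Inl (Suc k)) \<ominus> x (Inr (Suc k)) = h \<otimes> (x (Inl k) \<ominus> x (Inr k))"
      by (simp add: m_lcancel)
    then have "(x (Inl (Suc k)) \<ominus> h \<otimes> x (Inr k)) \<oplus> h \<otimes> x (Inr k)
        = h \<otimes> (x (Inl k) \<ominus> x (Inr k)) \<oplus> h \<otimes> x (Inr k)" by (simp add: elim(1))
    then show ?case
      using c[of "Inl (Suc k)"] c[of "Inl k"] c[of "Inr k"] h(1) by algebra
  qed
qed

text \<open>Congruence modulo \<open>ker_P\<close>, stated without subtraction.\<close>

definition equiv_P :: "(nat + nat \<Rightarrow> 'a) \<Rightarrow> (nat + nat \<Rightarrow> 'a) \<Rightarrow> bool" where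
  "equiv_P x y \<longleftrightarrow>
    (\<forall>k. x (Inl k) = y (Inl k)) \<and> (\<forall>\<^sub>F k in sequentially. x (Inr k) = y (Inr k))"

lemma equiv_P_equiv: "equiv_P x x" "equiv_P x y \<Longrightarrow> equiv_P y x"
  "equiv_P x y \<Longrightarrow> equiv_P y z \<Longrightarrow> equiv_P x z"
  by (auto simp: equiv_P_def elim: eventually_mono eventually_elim2)

text \<open>
  Both sequences are geometric from some index \<open>n\<close> on, so \<open>s 0, ..., s n\<close> and \<open>t n\<close> determine the element
  modulo \<open>ker_P\<close>; the index \<open>n\<close> is recovered from the length of the list.
\<close>

lemma ex_encoding:
  "\<exists>d. (\<forall>x\<in>pair_seqs. d x \<in> lists (carrier R)) \<and>
       (\<forall>x\<in>pair_seqs. \<forall>y\<in>pair_seqs. d x = d y \<longrightarrow> equiv_P x y)"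
proof -
  have "\<forall>x. \<exists>n. x \<in> pair_seqs \<longrightarrow>
      (\<forall>k\<ge>n. x (Inl (Suc k)) = h \<otimes> x (Inl k) \<and> x (Inr (Suc k)) = h \<otimes> x (Inr k))"
  proof
    fix x
    show "\<exists>n. x \<in> pair_seqs \<longrightarrow>
      (\<forall>k\<ge>n. x (Inl (Suc k)) = h \<otimes> x (Inl k) \<and> x (Inr (Suc k)) = h \<otimes> x (Inr k))"
    proof (cases "x \<in> pair_seqs")
      case True
      then have "\<forall>\<^sub>F k in sequentially. x (Inr (Suc k)) = h \<otimes> x (Inr k)"
        by (simp add: pair_seqs_def)
      from eventually_conj[OF eventually_geometric[OF True] this] show ?thesis
        by (simp add: eventually_sequentially)
    qed simp
  qed
  then obtain n where n: "\<And>x k. x \<in> pair_seqs \<Longrightarrow> n x \<le> k \<Longrightarrow> x (Inl (Suc k)) = h \<otimes> x (Inl k)"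
      "\<And>x k. x \<in> pair_seqs \<Longrightarrow> n x \<le> k \<Longrightarrow> x (Inr (Suc k)) = h \<otimes> x (Inr k)"
    unfolding choice_iff by blast
  \<comment> \<open>Including index \<open>n x\<close> supplies the starting value for the geometric part of both sequences.\<close>
  define d where "d x = x (Inr (n x)) # map (\<lambda>k. x (Inl k)) [0..<Suc (n x)]" for x
  have "d x \<in> lists (carrier R)" if "x \<in> pair_seqs" for x
    using pair_seqs_closed[OF that] by (auto simp: d_def)
  moreover have "equiv_P x y" if x: "x \<in> pair_seqs" and y: "y \<in> pair_seqs" and eq: "d x = d y" for x y
  proof -
    have "length (d x) = length (d y)" using eq by simp
    then have nn: "n x = n y" by (simp add: d_def)
    have r: "x (Inr (n x)) = y (Inr (n x))"
      and "map (\<lambda>k. x (Inl k)) [0..<Suc (n x)] = map (\<lambda>k. y (Inl k)) [0..<Suc (n x)]"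
      using eq by (simp_all add: d_def nn del: upt_Suc)
    then have le: "x (Inl k) = y (Inl k)" if "k \<le> n x" for k
      using that by (simp add: map_eq_conv del: upt_Suc)
    have ge: "x (Inl k) = y (Inl k) \<and> x (Inr k) = y (Inr k)" if "n x \<le> k" for k
      using that
    proof (induction k rule: dec_induct)
      case base
      then show ?case using r le by simp
    next
      case (step k)
      then show ?case using n[OF x, of k] n[OF y, of k] nn by simp
    qed
    show ?thesis
      unfolding equiv_P_def eventually_sequentially using le ge by (meson nat_le_linear)
  qed
  ultimately show ?thesis by blast
qed

text \<open>
  The quotient of \<open>P\<close> by \<open>ker_P\<close> has at most as many elements as there are finite lists over \<open>R\<close>, hence
  at most as many as the infinite set \<open>R\<close> has.
\<close>

lemma ex_model:
  assumes "\<exists>\<iota> :: 'a \<Rightarrow> 'm. inj_on \<iota> (carrier R)"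
  shows "\<exists>(C :: ('a, 'm) module) \<phi>. flat_tower_model R f g C \<phi>"
proof -
  from assms obtain \<iota> :: "'a \<Rightarrow> 'm" where \<iota>: "inj_on \<iota> (carrier R)" by blast
  obtain e where e: "inj_on e (lists (carrier R))" "e ` lists (carrier R) \<subseteq> carrier R"
    using ex_inj_lists[OF infinite_carrier] by blast
  obtain d where d: "\<And>x. x \<in> pair_seqs \<Longrightarrow> d x \<in> lists (carrier R)"
    "\<And>x y. x \<in> pair_seqs \<Longrightarrow> y \<in> pair_seqs \<Longrightarrow> d x = d y \<Longrightarrow> equiv_P x y"
    using ex_encoding by blast
  define rep where "rep x = (SOME y. y \<in> pair_seqs \<and> equiv_P x y)" for x
  have rep: "rep x \<in> pair_seqs" "equiv_P x (rep x)" if "x \<in> pair_seqs" for x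
    using someI[of "\<lambda>y. y \<in> pair_seqs \<and> equiv_P x y" x] that equiv_P_equiv(1)
    by (simp_all add: rep_def)
  define \<phi> where "\<phi> x = \<iota> (e (d (rep x)))" for x
  have \<phi>: "\<phi> x = \<phi> y \<longleftrightarrow> equiv_P x y" if xy: "x \<in> pair_seqs" "y \<in> pair_seqs" for x y
  proof
    assume "equiv_P x y"
    then have "equiv_P x z \<longleftrightarrow> equiv_P y z" for z
      using equiv_P_equiv(2)[of x y] equiv_P_equiv(3)[of x y z] equiv_P_equiv(3)[of y x z] by blast
    then show "\<phi> x = \<phi> y" by (simp add: \<phi>_def rep_def)
  next
    assume "\<phi> x = \<phi> y"
    then have "d (rep x) = d (rep y)"
      using e d(1) rep(1) xy by (auto simp: \<phi>_def inj_on_eq_iff[OF \<iota>] inj_on_eq_iff[OF e(1)] image_subset_iff)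
    then have "equiv_P (rep x) (rep y)" using d(2) rep(1) xy by blast
    from equiv_P_equiv(3)[OF rep(2)[OF xy(1)] this] equiv_P_equiv(2)[OF rep(2)[OF xy(2)]]
    show "equiv_P x y" by (rule equiv_P_equiv(3))
  qed
  have add: "\<phi> (x \<oplus>\<^bsub>P\<^esub> y) = \<phi> (x' \<oplus>\<^bsub>P\<^esub> y')"
    if "x \<in> carrier P" "x' \<in> carrier P" "y \<in> carrier P" "y' \<in> carrier P" "\<phi> x = \<phi> x'" "\<phi> y = \<phi> y'"
    for x x' y y'
    using that by (auto simp: \<phi> pair_seqs_add equiv_P_def elim: eventually_elim2)
  have smult: "\<phi> (r \<odot>\<^bsub>P\<^esub> x) = \<phi> (r \<odot>\<^bsub>P\<^esub> x')"
    if "r \<in> carrier R" "x \<in> carrier P" "x' \<in> carrier P" "\<phi> x = \<phi> x'" for r x x'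
    using that by (auto simp: \<phi> pair_seqs_smult equiv_P_def elim: eventually_mono)
  have "flat_tower_model R f g (image_module P \<phi>) \<phi>"
  proof (intro flat_tower_model.intro flat_tower_model_axioms.intro flat_tower_axioms)
    show "module R (image_module P \<phi>)"
      by (rule module_image_module[OF module_P]) (fact add smult)+
    show "\<phi> \<in> linear_maps R P (image_module P \<phi>)"
      by (rule image_module_proj[OF module_P]) (fact add smult)+
    show "\<phi> ` pair_seqs = carrier (image_module P \<phi>)"
      by (simp add: image_module_def Let_def)
    show "\<phi> x = \<zero>\<^bsub>image_module P \<phi>\<^esub> \<longleftrightarrow> x \<in> ker_P" if "x \<in> pair_seqs" for x
      using that \<phi>[OF that pair_seqs_zero]
      by (auto simp: image_module_def Let_def equiv_P_def ker_P_def)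
  qed
  then show ?thesis by blast
qed

end

section \<open>The dimension bound\<close>

text \<open>
  In a chain of primes of length two, \<open>f\<close> is taken from the top but not from the middle, and \<open>g\<close> from
  the middle but not from the bottom.
\<close>

lemma flat_tower_if_krull_dim:
  assumes "noetherian_domain R" "\<not> krull_dim R \<le> 1"
  shows "\<exists>f g. flat_tower R f g"
proof -
  interpret noetherian_domain R by fact
  from assms(2) obtain n and P :: "nat \<Rightarrow> 'a set" where "\<not> enat n \<le> 1"
    and prime: "\<And>i. i \<le> n \<Longrightarrow> primeideal (P i) R" and chain: "\<And>i. i < n \<Longrightarrow> P i \<subset> P (Suc i)"
    unfolding krull_dim_def Sup_le_iff by blast
  then have n: "2 \<le> n" by (cases n) (auto simp: one_enat_def)
  interpret P0: primeideal "P 0" R by (rule prime) simp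
  interpret P1: primeideal "P 1" R by (rule prime) (use n in simp)
  interpret P2: primeideal "P 2" R by (rule prime) (use n in simp)
  obtain f where f: "f \<in> P 2" "f \<notin> P 1"
    using chain[of 1] n by (auto simp: numeral_2_eq_2)
  obtain g where g: "g \<in> P 1" "g \<notin> P 0"
    using chain[of 0] n by auto
  have fR: "f \<in> carrier R" using f(1) by (rule P2.Icarr)
  have pow: "f [^]\<^bsub>R\<^esub> m \<notin> P 1" for m :: nat
  proof (induction m)
    case 0
    then show ?case using P1.one_imp_carrier P1.I_notcarr by auto
  next
    case (Suc m)
    then show ?case using P1.I_prime[of "f [^]\<^bsub>R\<^esub> m" f] fR f(2) by auto
  qed
  have "flat_tower R f g"
  proof unfold_locales
    show "f \<in> carrier R" "g \<in> carrier R" using fR g P1.Icarr by auto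
    show "f \<noteq> \<zero>\<^bsub>R\<^esub>" "g \<noteq> \<zero>\<^bsub>R\<^esub>" using f g P0.zero_closed P1.zero_closed by auto
    show "f \<notin> Units R"
    proof
      assume "f \<in> Units R"
      then have "\<one>\<^bsub>R\<^esub> \<in> P 2" using f(1) P2.I_l_closed[OF f(1), of "inv\<^bsub>R\<^esub> f"] by simp
      then show False using P2.one_imp_carrier P2.I_notcarr by auto
    qed
    show "f [^]\<^bsub>R\<^esub> m \<noteq> r \<otimes>\<^bsub>R\<^esub> g" if "r \<in> carrier R" for r and m :: nat
      using pow[of m] P1.I_l_closed[OF g(1) that] by auto
  qed
  then show ?thesis by blast
qed

theorem mainTheorem5:
  fixes R :: "('a, 'b) ring_scheme" and \<mm> :: "'a set"
  assumes "noetherian_domain R"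
    and "local_ring R \<mm>"
    (* 'm is the type in which the R-modules live; it only has to be large enough for R *)
    and "\<exists>f :: 'a \<Rightarrow> 'm. inj_on f (carrier R)"
    and "\<And>(A :: 'm set) (B :: 'm set) (C :: ('a, 'm) module).
           \<lbrakk>module R C; submodule B R C;
            pure_essential R (C\<lparr>carrier := B\<rparr>) A; pure_essential R C B\<rbrakk>
           \<Longrightarrow> pure_essential R C A"
  shows "krull_dim R \<le> 1"
proof (rule ccontr)
  assume "\<not> krull_dim R \<le> 1"
  then obtain f g where fg: "flat_tower R f g" using flat_tower_if_krull_dim assms(1) by blast
  obtain C :: "('a, 'm) module" and \<phi> where "flat_tower_model R f g C \<phi>"
    using flat_tower.ex_model[OF fg assms(3)] by blast
  then interpret flat_tower_model R f g C \<phi> .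
  show False
    using assms(4)[OF module_C submodule_images(2) pure_essential_A_B pure_essential_B_C]
      not_pure_essential_A_C by blast
qed

end
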